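(* Let $M(\omega)$, $\omega\in\Omega$, be a random reduced dynamics operator on $\mathbb{C}^d$ with probability space $(\Omega,\mathcal{F},\mathrm{p})$, and suppose that $\mathrm{p}(M(\omega)\in\mathcal{M}_{(E)})>0$. Then there exist a set $\Omega_1\subset\Omega^{\mathbb{N}^*}$ and constants $C,\alpha>0$ such that $\mathbb{P}(\Omega_1)=1$ and such that for any $\overline\omega=(\omega_j)_{j\ge1}\in\Omega_1$ there exists $n_0(\overline\omega)$ such that for any $n\ge n_0(\overline\omega)$, $$\|M_Q(\omega_1)M_Q(\omega_2)\cdots M_Q(\omega_n)\|\le C e^{-\alpha n}.$$
   Context: Inner products on $\mathbb{C}^d$ are linear in the second factor; $\|\cdot\|$ is the Euclidean norm and the induced operator norm; $|\psi\rangle\langle\phi|$ denotes $\chi\mapsto\langle\phi,\chi\rangle\psi$. $\mathbb{N}^*=\{1,2,\dots\}$. A random reduced dynamics operator (RRDO) is a measurable map $\omega\mapsto M(\omega)\in M_d(\mathbb{C})$ on a probability space $(\Omega,\mathcal{F},\mathrm{p})$ such that: (1) there is a norm $|||\cdot|||$ on $\mathbb{C}^d$ (independent of $\omega$) for which every $M(\omega)$ is a contraction; (2) there is a vector $\psi_{\mathcal S}$, independent of $\omega$, normalized by $\|\psi_{\mathcal S}\|=1$, with $M(\omega)\psi_{\mathcal S}=\psi_{\mathcal S}$ for all $\omega$. $\mathcal{M}_{(E)}$ is the set of matrices $M$ with $|||M|||\le1$ and $M\psi_{\mathcal S}=\psi_{\mathcal S}$ whose spectrum on the complex unit circle consists only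 of the simple eigenvalue $1$. Let $P_1(\omega)$ be the spectral (Riesz) projection of $M(\omega)$ for the eigenvalue $1$; set $\psi(\omega)=P_1(\omega)^*\psi_{\mathcal S}$, $P(\omega)=|\psi_{\mathcal S}\rangle\langle\psi(\omega)|$ (a projection, as $\langle\psi_{\mathcal S},\psi(\omega)\rangle=1$), $Q(\omega)=\mathbf{1}-P(\omega)$, and $M_Q(\omega)=Q(\omega)M(\omega)Q(\omega)$; one has $M(\omega)=P(\omega)+M_Q(\omega)$. $\mathbb{P}=\prod_{j\ge1}\mathrm{p}$ is the product probability measure on $\Omega^{\mathbb{N}^*}$. *)

theory Defs
  imports
    "HOL-Probability.Probability"
    "HOL-Complex_Analysis.Complex_Analysis"
    "HOL-Computational_Algebra.Polynomial"
begin

(* The library's inner product on complex ^ 'd is the real one, so the sesquilinear product,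
   linear in the second argument, is introduced here.  The library norm on complex ^ 'd is the
   Euclidean norm, and the induced operator norm of a matrix A is onorm (\<lambda>x. A *v x). *)
definition c_inner :: "complex ^ 'd \<Rightarrow> complex ^ 'd \<Rightarrow> complex" where
  "c_inner x y = (\<Sum>i\<in>UNIV. cnj (x $ i) * y $ i)"

definition mat_adjoint :: "complex ^ 'd ^ 'd \<Rightarrow> complex ^ 'd ^ 'd" where
  "mat_adjoint A = (\<chi> i j. cnj (A $ j $ i))"

definition ket_bra :: "complex ^ 'd \<Rightarrow> complex ^ 'd \<Rightarrow> complex ^ 'd ^ 'd" where
  "ket_bra \<psi> \<phi> = matrix (\<lambda>v. c_inner \<phi> v *s \<psi>)"

definition is_complex_norm :: "(complex ^ 'd \<Rightarrow> real) \<Rightarrow> bool" where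
  "is_complex_norm N \<longleftrightarrow>
     (\<forall>x. 0 \<le> N x) \<and> (\<forall>x. N x = 0 \<longleftrightarrow> x = 0) \<and>
     (\<forall>c x. N (c *s x) = cmod c * N x) \<and> (\<forall>x y. N (x + y) \<le> N x + N y)"

(* The operator norm of A induced by N is at most 1. *)
definition is_contraction :: "(complex ^ 'd \<Rightarrow> real) \<Rightarrow> complex ^ 'd ^ 'd \<Rightarrow> bool" where
  "is_contraction N A \<longleftrightarrow> (\<forall>x. N (A *v x) \<le> N x)"

definition mat_spectrum :: "complex ^ 'd ^ 'd \<Rightarrow> complex set" where
  "mat_spectrum A = {z. \<not> invertible (mat z - A)}"

definition characteristic_poly :: "complex ^ 'd ^ 'd \<Rightarrow> complex poly" where
  "characteristic_poly A = det (\<chi> i j. (if i = j then [:0, 1:] else 0) - [:A $ i $ j:])"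

definition simple_eigenvalue :: "complex ^ 'd ^ 'd \<Rightarrow> complex \<Rightarrow> bool" where
  "simple_eigenvalue A z \<longleftrightarrow> order z (characteristic_poly A) = 1"

locale RRDO = prob_space p
  for p :: "'w measure" +
  fixes M :: "'w \<Rightarrow> complex ^ 'd ^ 'd"
    and N :: "complex ^ 'd \<Rightarrow> real"
    and \<psi>S :: "complex ^ 'd"
  assumes measurable_M: "M \<in> borel_measurable p"
    and norm_N: "is_complex_norm N"
    and contraction_M: "\<And>\<omega>. \<omega> \<in> space p \<Longrightarrow> is_contraction N (M \<omega>)"
    and norm_\<psi>S: "norm \<psi>S = 1"
    and invariant_\<psi>S: "\<And>\<omega>. \<omega> \<in> space p \<Longrightarrow> M \<omega> *v \<psi>S = \<psi>S"

definition M_E :: "(complex ^ 'd \<Rightarrow> real) \<Rightarrow> complex ^ 'd \<Rightarrow> (complex ^ 'd ^ 'd) set" where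
  "M_E N \<psi>S = {A. is_contraction N A \<and> A *v \<psi>S = \<psi>S \<and>
     mat_spectrum A \<inter> sphere 0 1 = {1} \<and> simple_eigenvalue A 1}"

(* Entrywise (1 / (2 pi i)) times the contour integral of the resolvent (z - A)^(-1) over a circle
   around \<mu> that encloses no other point of the spectrum; by Cauchy's theorem the value does
   not depend on the radius chosen. *)
definition riesz_projection :: "complex ^ 'd ^ 'd \<Rightarrow> complex \<Rightarrow> complex ^ 'd ^ 'd" where
  "riesz_projection A \<mu> =
     (let r = (SOME r. 0 < r \<and> mat_spectrum A \<inter> cball \<mu> r \<subseteq> {\<mu>})
      in \<chi> i j. 1 / (2 * of_real pi * \<i>) *
           contour_integral (circlepath \<mu> r) (\<lambda>z. matrix_inv (mat z - A) $ i $ j))"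

definition psi_vec :: "complex ^ 'd \<Rightarrow> complex ^ 'd ^ 'd \<Rightarrow> complex ^ 'd" where
  "psi_vec \<psi>S A = mat_adjoint (riesz_projection A 1) *v \<psi>S"

definition P_mat :: "complex ^ 'd \<Rightarrow> complex ^ 'd ^ 'd \<Rightarrow> complex ^ 'd ^ 'd" where
  "P_mat \<psi>S A = ket_bra \<psi>S (psi_vec \<psi>S A)"

definition Q_mat :: "complex ^ 'd \<Rightarrow> complex ^ 'd ^ 'd \<Rightarrow> complex ^ 'd ^ 'd" where
  "Q_mat \<psi>S A = mat 1 - P_mat \<psi>S A"

definition MQ_mat :: "complex ^ 'd \<Rightarrow> complex ^ 'd ^ 'd \<Rightarrow> complex ^ 'd ^ 'd" where
  "MQ_mat \<psi>S A = Q_mat \<psi>S A ** A ** Q_mat \<psi>S A"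

(* The ordered product B 1 ** B 2 ** ... ** B n, with new factors on the right. *)
primrec ordered_prod :: "(nat \<Rightarrow> complex ^ 'd ^ 'd) \<Rightarrow> nat \<Rightarrow> complex ^ 'd ^ 'd" where
  "ordered_prod B 0 = mat 1"
| "ordered_prod B (Suc n) = ordered_prod B n ** B (Suc n)"

end

theory Submission
  imports Defs "HOL-Computational_Algebra.Fundamental_Theorem_Algebra"
begin

text \<open>
  Since \<open>P M = P = M P\<close> and every \<open>M\<close> fixes \<open>\<psi>\<^sub>S\<close>, the product telescopes:
  \<open>M\<^sub>Q(\<omega>\<^sub>1) \<dots> M\<^sub>Q(\<omega>\<^sub>n) = Q(\<omega>\<^sub>1) M(\<omega>\<^sub>1) \<dots> M(\<omega>\<^sub>n)\<close>. As \<open>Q(\<omega>\<^sub>1)\<close> kills \<open>\<psi>\<^sub>S\<close>, it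
  suffices to let the product decay on the quotient \<open>\<complex>\<^sup>d / \<complex> \<psi>\<^sub>S\<close>, on which all \<open>M(\<omega>)\<close> are
  contractions; the possibly unbounded factor \<open>Q(\<omega>\<^sub>1)\<close> is absorbed into \<open>n\<^sub>0\<close> by halving the rate.
  By the Lindelof property some \<open>A\<close> in \<open>M\<^sub>E\<close> has only neighbourhoods of positive probability. The
  powers of \<open>A\<close> tend to \<open>0\<close> on the quotient, so products of some fixed number \<open>l\<close> of contractions
  close to \<open>A\<close> are at most \<open>1/2\<close> there. Disjoint blocks of \<open>l\<close> factors are independent, hence the
  expected product of the block bounds is \<open>r\<^sup>n\<close> with \<open>r < 1\<close>, and Markov's inequality and the
  Borel-Cantelli lemma turn this into almost sure decay like \<open>(\<surd>r)\<^sup>n\<close>.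
\<close>

no_notation fps_nth (infixl "$" 75)

subsection \<open>Annihilating products of linear factors\<close>

text \<open>The product of the factors \<open>A - l\<close> over the list, applied to
  \<open>v\<close>, head first. Acting on a vector instead of forming a matrix polynomial lets the
  list depend on \<open>v\<close>.\<close>

fun linear_factors :: "complex ^ 'd ^ 'd \<Rightarrow> complex list \<Rightarrow> complex ^ 'd \<Rightarrow> complex ^ 'd" where
  "linear_factors A [] v = v"
| "linear_factors A (l # ls) v = linear_factors A ls (A *v v - l *s v)"

lemma linear_factors_zero [simp]: "linear_factors A ls 0 = 0"
  by (induction ls) (auto simp: vec.zero)

text \<open>Polynomials in \<open>A\<close> commute, so a factor applied first may be read as one
  applied last.\<close>

lemma linear_factors_commute:
  "linear_factors A ls (A *v v - l *s v) = A *v linear_factors A ls v - l *s linear_factors A ls v"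
proof (induction ls arbitrary: v)
  case (Cons m ls)
  have "A *v (A *v v - l *s v) - m *s (A *v v - l *s v) = A *v (A *v v - m *s v) - l *s (A *v v - m *s v)"
    by (simp add: vec.diff vec.scale vec.scale_right_diff_distrib algebra_simps)
  then show ?case by (simp only: linear_factors.simps Cons.IH)
qed simp

text \<open>Over the complex numbers \<open>f\<close> has a root \<open>l\<close>; writing
  \<open>f = (X - l) g\<close>, the cofactor \<open>g\<close> annihilates \<open>(A - l) v\<close>,
  and induction on the degree splits off the remaining roots.\<close>

lemma polynomial_annihilator_factors:
  fixes A :: "complex ^ 'd ^ 'd"
  assumes "f \<noteq> 0" "degree f = n" "(\<Sum>i\<le>n. coeff f i *s (((*v) A ^^ i) v)) = 0"
  shows "\<exists>ls. linear_factors A ls v = 0"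
  using assms
proof (induction n arbitrary: f v)
  case 0
  then have "coeff f 0 \<noteq> 0"
    by (metis leading_coeff_neq_0)
  with 0 have "linear_factors A [] v = 0"
    by simp
  then show ?case by blast
next
  case (Suc n)
  then have "\<not> constant (poly f)"
    using constant_degree[of f] by simp
  then obtain l where "poly f l = 0"
    using fundamental_theorem_of_algebra by blast
  then obtain g where g: "f = [:-l, 1:] * g"
    using poly_eq_0_iff_dvd by (metis dvdE)
  have g0: "g \<noteq> 0" using Suc.prems g by auto
  then have dg: "degree g = n"
    using Suc.prems(2) unfolding g by (subst (asm) degree_mult_eq) auto
  have c0: "coeff f 0 = - l * coeff g 0" and cS: "coeff f (Suc i) = coeff g i - l * coeff g (Suc i)" for i
    by (simp_all add: g)
  have gS: "coeff g (Suc n) = 0" using dg by (simp add: coeff_eq_0)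
  let ?P = "\<lambda>i. ((*v) A ^^ i)"
  have diff: "?P i (x - c *s y) = ?P i x - c *s ?P i y" for i x c y
    by (induction i) (simp_all add: vec.diff vec.scale)
  have "(\<Sum>i\<le>n. coeff g i *s ?P i (A *v v - l *s v)) =
        (\<Sum>i\<le>n. coeff g i *s ?P (Suc i) v) - l *s (\<Sum>i\<le>n. coeff g i *s ?P i v)"
    by (simp add: diff sum_subtractf vec.scale_right_diff_distrib vec.scale_sum_right
        funpow_swap1 mult.commute)
  \<comment> \<open>The zero coefficient at \<open>Suc n\<close> lengthens the sum, so that after an
    index shift it runs over the same powers as the first sum.\<close>
  also have "(\<Sum>i\<le>n. coeff g i *s ?P i v) = (\<Sum>i\<le>Suc n. coeff g i *s ?P i v)"
    by (simp add: gS)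
  also have "\<dots> = coeff g 0 *s v + (\<Sum>i\<le>n. coeff g (Suc i) *s ?P (Suc i) v)"
    by (subst sum.atMost_Suc_shift) simp
  also have "(\<Sum>i\<le>n. coeff g i *s ?P (Suc i) v) - l *s (coeff g 0 *s v + (\<Sum>i\<le>n. coeff g (Suc i) *s ?P (Suc i) v))
     = (\<Sum>i\<le>Suc n. coeff f i *s ?P i v)"
    by (subst sum.atMost_Suc_shift)
      (simp add: c0 cS vec.scale_left_diff_distrib sum_subtractf vec.scale_sum_right
        vec.scale_right_distrib algebra_simps del: funpow.simps)
  finally have "(\<Sum>i\<le>n. coeff g i *s ?P i (A *v v - l *s v)) = 0"
    using Suc.prems by simp
  from Suc.IH[OF g0 dg this] obtain ls where "linear_factors A ls (A *v v - l *s v) = 0" by blast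
  then have "linear_factors A (l # ls) v = 0" by simp
  then show ?case by blast
qed

text \<open>The \<open>d + 1\<close> vectors \<open>v, A v, ..., A^d v\<close> are linearly
  dependent, and a dependence relation is a nonzero polynomial annihilating
  \<open>v\<close>.\<close>

lemma linear_factors_annihilate:
  fixes A :: "complex ^ 'd ^ 'd"
  shows "\<exists>ls. linear_factors A ls v = 0"
proof -
  let ?P = "\<lambda>i. ((*v) A ^^ i) v"
  define m where "m = CARD('d)"
  have "\<exists>c. (\<exists>i\<le>m. c i \<noteq> 0) \<and> (\<Sum>i\<le>m. c i *s ?P i) = 0"
  \<comment> \<open>Dependence is a property of sets of vectors, so a repeated iterate has to supply
    its relation separately.\<close>
  proof (cases "inj_on ?P {..m}")
    case False
    then obtain i j where ij: "i \<le> m" "j \<le> m" "i \<noteq> j" "?P i = ?P j"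
      unfolding inj_on_def by blast
    define c :: "nat \<Rightarrow> complex" where "c k = (if k = i then 1 else 0) - (if k = j then 1 else 0)" for k
    have "(\<Sum>k\<le>m. c k *s ?P k) = (\<Sum>k\<le>m. if k = i then ?P k else 0) - (\<Sum>k\<le>m. if k = j then ?P k else 0)"
      unfolding sum_subtractf[symmetric]
      by (intro sum.cong refl) (auto simp: c_def vec.scale_left_diff_distrib)
    also have "\<dots> = 0" using ij by (simp add: sum.delta)
    finally show ?thesis using ij by (intro exI[of _ c]) (auto simp: c_def)
  next
    case True
    have "card (?P ` {..m}) = Suc m"
      using True by (simp add: card_image)
    moreover have "vec.dim (?P ` {..m}) \<le> m"
      unfolding m_def by (rule dim_subset_UNIV_cart_gen)
    ultimately have "vec.dependent (?P ` {..m})"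
      by (intro vec.dependent_biggerset_general) linarith
    then obtain u where u: "\<exists>w\<in>?P ` {..m}. u w \<noteq> 0" "(\<Sum>w\<in>?P ` {..m}. u w *s w) = 0"
      by (subst (asm) vec.dependent_finite) auto
    then show ?thesis
      using True by (intro exI[of _ "\<lambda>i. u (?P i)"]) (auto simp: sum.reindex)
  qed
  then obtain c where c: "\<exists>i\<le>m. c i \<noteq> 0" "(\<Sum>i\<le>m. c i *s ?P i) = 0" by blast
  define f where "f = Poly (map c [0..<Suc m])"
  have cf: "coeff f i = (if i \<le> m then c i else 0)" for i
    unfolding f_def coeff_Poly_eq nth_default_def
    by (auto simp del: upt_Suc simp: less_Suc_eq_le)
  have f0: "f \<noteq> 0" using c(1) cf by (metis coeff_0)
  have "degree f \<le> m" by (rule degree_le) (simp add: cf)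
  then have "(\<Sum>i\<le>degree f. coeff f i *s ?P i) = (\<Sum>i\<le>m. coeff f i *s ?P i)"
    by (intro sum.mono_neutral_left) (auto simp: coeff_eq_0)
  also have "\<dots> = 0" using c(2) by (simp add: cf)
  finally show ?thesis
    using polynomial_annihilator_factors[OF f0 refl] by blast
qed

section \<open>Spectrum and eigenvectors\<close>

lemma mat_minus_vector_mult:
  fixes A :: "complex ^ 'd ^ 'd"
  shows "(mat z - A) *v w = z *s w - A *v w"
proof -
  have "mat z *v w = z *s w"
    by (simp add: matrix_vector_mult_def mat_def vec_eq_iff if_distrib[of "\<lambda>x. x * _"] cong: if_cong)
  then show ?thesis by (simp add: matrix_vector_mult_diff_rdistrib)
qed

lemma mat_spectrum_iff:
  fixes A :: "complex ^ 'd ^ 'd"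
  shows "z \<in> mat_spectrum A \<longleftrightarrow> (\<exists>w. w \<noteq> 0 \<and> A *v w = z *s w)"
proof -
  have "(mat z - A) *v w = 0 \<longleftrightarrow> A *v w = z *s w" for w
    by (auto simp: mat_minus_vector_mult)
  then show ?thesis
    unfolding mat_spectrum_def mem_Collect_eq invertible_left_inverse matrix_left_invertible_ker
    by auto
qed

text \<open>If \<open>l\<close> is not an eigenvalue, \<open>A - l\<close> is injective; commuted to
  the last position it can be cancelled.\<close>

lemma linear_factors_filter_spectrum:
  assumes "linear_factors A ls v = 0"
  shows "linear_factors A (filter (\<lambda>l. l \<in> mat_spectrum A) ls) v = 0"
  using assms
proof (induction ls arbitrary: v)
  case (Cons l ls)
  show ?case
  proof (cases "l \<in> mat_spectrum A")
    case True
    then show ?thesis using Cons by simp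
  next
    case False
    from Cons.prems have "A *v linear_factors A ls v = l *s linear_factors A ls v"
      by (simp add: linear_factors_commute)
    with False have "linear_factors A ls v = 0"
      unfolding mat_spectrum_iff by blast
    with Cons.IH False show ?thesis by simp
  qed
qed simp

lemma linear_factors_annihilate_spectrum:
  obtains ls where "set ls \<subseteq> mat_spectrum A" "linear_factors A ls v = 0"
proof -
  obtain ls where "linear_factors A ls v = 0"
    using linear_factors_annihilate by blast
  then show ?thesis
    using that[of "filter (\<lambda>l. l \<in> mat_spectrum A) ls"] linear_factors_filter_spectrum by auto
qed

subsection \<open>Contractions and the quotient seminorm\<close>

locale complex_norm =
  fixes N :: "complex ^ 'd \<Rightarrow> real"
  assumes is_norm: "is_complex_norm N"
begin

lemma N_nonneg [simp]: "0 \<le> N x"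
  and N_eq_0_iff [simp]: "N x = 0 \<longleftrightarrow> x = 0"
  and N_scale: "N (c *s x) = cmod c * N x"
  and N_triangle: "N (x + y) \<le> N x + N y"
  using is_norm by (auto simp: is_complex_norm_def)

lemma N_zero [simp]: "N 0 = 0"
  by simp

lemma N_uminus: "N (- x) = N x"
  using N_scale[of "-1" x] by simp

lemma N_diff: "N (x - y) \<le> N x + N y"
  using N_triangle[of x "-y"] by (simp add: N_uminus)

lemma N_sum: "N (\<Sum>i\<in>I. f i) \<le> (\<Sum>i\<in>I. N (f i))"
proof (induction I rule: infinite_finite_induct)
  case (insert i I)
  then show ?case using N_triangle[of "f i" "\<Sum>i\<in>I. f i"] by simp
qed simp_all

lemma N_le_norm: obtains C where "C > 0" "\<And>x. N x \<le> C * norm x"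
proof -
  define C where "C = 1 + (\<Sum>i\<in>UNIV. N (axis i 1))"
  have "N x \<le> C * norm x" for x
  proof -
    have "N x = N (\<Sum>i\<in>UNIV. x $ i *s axis i 1)"
      by (simp add: basis_expansion)
    also have "\<dots> \<le> (\<Sum>i\<in>UNIV. N (x $ i *s axis i 1))"
      by (rule N_sum)
    also have "\<dots> \<le> (\<Sum>i\<in>UNIV. norm x * N (axis i 1))"
      by (intro sum_mono) (auto simp: N_scale intro!: mult_right_mono Finite_Cartesian_Product.norm_nth_le)
    also have "\<dots> \<le> C * norm x"
      by (simp add: C_def sum_distrib_left algebra_simps)
    finally show ?thesis .
  qed
  moreover have "C > 0"
    unfolding C_def by (intro add_pos_nonneg sum_nonneg) auto
  ultimately show ?thesis using that by blast
qed

text \<open>Equivalence of norms: \<open>N\<close> is Lipschitz, hence attains a minimum on the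
  compact Euclidean unit sphere, which is positive; homogeneity does the rest.\<close>

lemma norm_le_N: obtains K where "K > 0" "\<And>x. norm x \<le> K * N x"
proof -
  obtain C where C: "C > 0" "\<And>x. N x \<le> C * norm x" using N_le_norm by blast
  have "\<bar>N x - N y\<bar> \<le> C * norm (x - y)" for x y
  proof -
    have "N x \<le> N y + N (x - y)" using N_triangle[of y "x - y"] by simp
    moreover have "N y \<le> N x + N (x - y)" using N_diff[of x "x - y"] by simp
    ultimately show ?thesis using C(2)[of "x - y"] by linarith
  qed
  then have "C-lipschitz_on UNIV N"
    using C(1) by (auto intro!: lipschitz_onI simp: dist_norm)
  then have "continuous_on (sphere 0 1) N"
    by (meson continuous_on_subset lipschitz_on_continuous_on top_greatest)
  \<comment> \<open>A witness that the sphere is nonempty.\<close>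
  moreover have "axis undefined 1 \<in> (sphere 0 1 :: (complex ^ 'd) set)"
    by (simp add: norm_axis_1)
  ultimately obtain x0 where x0: "x0 \<in> sphere 0 1" "\<And>y. y \<in> sphere 0 1 \<Longrightarrow> N x0 \<le> N y"
    using continuous_attains_inf[of "sphere 0 1" N] by (metis compact_sphere empty_iff)
  have "x0 \<noteq> 0" using x0(1) by auto
  then have m: "N x0 > 0" using N_nonneg[of x0] N_eq_0_iff[of x0] by linarith
  have "norm x \<le> 1 / N x0 * N x" for x
  proof (cases "x = 0")
    case False
    let ?y = "complex_of_real (1 / norm x) *s x"
    have "?y = (1 / norm x) *\<^sub>R x"
      by (intro vec_eq_iff[THEN iffD2] allI, simp only: vector_scaleR_component vector_smult_component)
        (simp add: scaleR_conv_of_real)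
    then have "norm ?y = 1" using False by simp
    then have "N x0 \<le> N ?y" using x0(2) by simp
    also have "\<dots> = N x / norm x" by (simp add: N_scale norm_divide)
    finally show ?thesis using False m by (simp add: field_simps)
  qed (auto simp: m)
  then show ?thesis using that[of "1 / N x0"] m by simp
qed

lemma eigenvalue_contraction:
  assumes "is_contraction N A" "z \<in> mat_spectrum A"
  shows "cmod z \<le> 1"
proof -
  obtain w where w: "w \<noteq> 0" "A *v w = z *s w"
    using assms(2) mat_spectrum_iff by blast
  have "cmod z * N w \<le> 1 * N w"
    using assms(1) w(2) by (metis N_scale is_contraction_def mult_1)
  moreover have "N w > 0" using w(1) N_nonneg[of w] N_eq_0_iff[of w] by linarith
  ultimately show ?thesis by (simp only: mult_le_cancel_right_pos)
qed

text \<open>A Jordan chain at the eigenvalue 1 would give \<open>A^n u = u + n w\<close>, whose norm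
  grows linearly unless \<open>w = 0\<close>, while a contraction keeps it below
  \<open>N u\<close>.\<close>

lemma contraction_fixed_space_semisimple:
  assumes A: "is_contraction N A" and w: "A *v w = w" and u: "A *v u = u + w"
  shows "w = 0"
proof -
  have pow: "((*v) A ^^ n) u = u + of_nat n *s w" for n
    by (induction n) (simp_all add: vec.add vec.scale u w vec.scale_left_distrib algebra_simps)
  have "N (((*v) A ^^ n) u) \<le> N u" for n
  proof (induction n)
    case (Suc n)
    then show ?case using A by (auto simp: is_contraction_def intro: order_trans)
  qed simp
  then have "N (u + of_nat n *s w) \<le> N u" for n by (simp add: pow)
  then have "real n * N w \<le> 2 * N u" for n
    using N_diff[of "u + of_nat n *s w" u] N_scale[of "of_nat n" w]
    by (smt (verit) add_diff_cancel_left' norm_of_nat)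
  then have "\<not> N w > 0"
    by (meson linorder_not_le reals_Archimedean3)
  then show ?thesis using N_nonneg[of w] by (simp add: not_less_iff_gr_or_eq)
qed

text \<open>By semisimplicity \<open>(A - 1)^2 u = 0\<close> forces \<open>(A - 1) u = 0\<close>, so
  on the range of \<open>A - 1\<close> further factors \<open>A - 1\<close> may be dropped.\<close>

lemma linear_factors_filter_one:
  assumes A: "is_contraction N A" and "linear_factors A ls (A *v v - v) = 0"
  shows "linear_factors A (filter (\<lambda>l. l \<noteq> 1) ls) (A *v v - v) = 0"
  using assms(2)
proof (induction ls arbitrary: v)
  case (Cons l ls)
  show ?case
  proof (cases "l = 1")
    case True
    let ?u = "linear_factors A ls v"
    have comm: "linear_factors A ls (A *v x - x) = A *v linear_factors A ls x - linear_factors A ls x" for x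
      using linear_factors_commute[of A ls x 1] by simp
    have "A *v (A *v ?u - ?u) - (A *v ?u - ?u) = 0"
      using Cons.prems True by (simp add: comm)
    then have "A *v ?u - ?u = 0"
      by (intro contraction_fixed_space_semisimple[OF A, where u = ?u]) simp_all
    then have "linear_factors A ls (A *v v - v) = 0" by (simp add: comm)
    with Cons.IH True show ?thesis by simp
  next
    case False
    let ?v = "A *v v - l *s v"
    have "A *v (A *v v - v) - l *s (A *v v - v) = A *v ?v - ?v"
      by (simp add: vec.diff vec.scale vec.scale_right_diff_distrib algebra_simps)
    then show ?thesis using Cons.prems Cons.IH[of ?v] False by (simp only: linear_factors.simps filter.simps simp_thms if_True)
  qed
qed simp

text \<open>The absence of 1 from the list is used twice: for matrices in \<open>M_E\<close> it
  leaves only eigenvalues inside the unit disc, and in the Riesz integral it leaves no singularity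
  inside the contour.\<close>

lemma linear_factors_annihilate_range:
  assumes "is_contraction N A"
  obtains ls where "set ls \<subseteq> mat_spectrum A - {1}" "linear_factors A ls (A *v v - v) = 0"
proof -
  obtain ls where ls: "set ls \<subseteq> mat_spectrum A" "linear_factors A ls (A *v v - v) = 0"
    using linear_factors_annihilate_spectrum[of A] by blast
  then show ?thesis
    using that[of "filter (\<lambda>l. l \<noteq> 1) ls"] linear_factors_filter_one[OF assms] by auto
qed

text \<open>The distance from \<open>x\<close> to the line spanned by \<open>y\<close>, that is, the
  quotient norm of the class of \<open>x\<close> modulo that line, kept as a seminorm on the full
  space.\<close>

definition quotient_norm :: "complex ^ 'd \<Rightarrow> complex ^ 'd \<Rightarrow> real" where
  "quotient_norm y x = (INF c. N (x - c *s y))"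

lemma quotient_norm_le: "quotient_norm y x \<le> N (x - c *s y)"
  unfolding quotient_norm_def by (rule cINF_lower) (auto intro!: bdd_belowI[of _ 0])

lemma quotient_norm_greatest: "(\<And>c. b \<le> N (x - c *s y)) \<Longrightarrow> b \<le> quotient_norm y x"
  unfolding quotient_norm_def by (rule cINF_greatest) auto

lemma quotient_norm_nonneg: "0 \<le> quotient_norm y x"
  by (rule quotient_norm_greatest) simp

lemma quotient_norm_le_N: "quotient_norm y x \<le> N x"
  using quotient_norm_le[of y x 0] by simp

text \<open>Passes an estimate with a factor \<open>b\<close> to the infimum; \<open>b = 0\<close>
  is separate because the proof divides by \<open>b\<close>.\<close>

lemma quotient_norm_scale_greatest:
  assumes "0 \<le> b" "\<And>c. a \<le> b * N (x - c *s y)"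
  shows "a \<le> b * quotient_norm y x"
proof (cases "b = 0")
  case False
  have "a / b \<le> quotient_norm y x"
    using assms False by (intro quotient_norm_greatest) (simp add: field_simps)
  then show ?thesis using assms(1) False by (simp add: field_simps)
qed (use assms(2) in simp)

text \<open>The infimum is taken over one shift at a time, first \<open>d\<close>, then
  \<open>c\<close>.\<close>

lemma quotient_norm_triangle: "quotient_norm y (x + z) \<le> quotient_norm y x + quotient_norm y z"
proof -
  have "quotient_norm y (x + z) - N (x - c *s y) \<le> N (z - d *s y)" for c d
  proof -
    have "quotient_norm y (x + z) \<le> N ((x - c *s y) + (z - d *s y))"
      using quotient_norm_le[of y "x + z" "c + d"]
      by (simp add: vec.scale_left_distrib algebra_simps)
    then show ?thesis using N_triangle[of "x - c *s y" "z - d *s y"] by linarith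
  qed
  then have "quotient_norm y (x + z) - N (x - c *s y) \<le> quotient_norm y z" for c
    by (rule quotient_norm_greatest)
  then have "quotient_norm y (x + z) - quotient_norm y z \<le> N (x - c *s y)" for c
    by (simp add: algebra_simps)
  then have "quotient_norm y (x + z) - quotient_norm y z \<le> quotient_norm y x"
    by (rule quotient_norm_greatest)
  then show ?thesis by simp
qed

lemma quotient_norm_scale: "quotient_norm y (a *s x) \<le> cmod a * quotient_norm y x"
proof (rule quotient_norm_scale_greatest)
  show "quotient_norm y (a *s x) \<le> cmod a * N (x - c *s y)" for c
    using quotient_norm_le[of y "a *s x" "a * c"]
    by (simp add: N_scale[symmetric] vec.scale_right_diff_distrib)
qed simp

lemma quotient_norm_multiple: "quotient_norm y (c *s y) = 0"
  using quotient_norm_le[of y "c *s y" c] quotient_norm_nonneg[of y "c *s y"] by simp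

text \<open>Since \<open>A\<close> fixes \<open>y\<close>, it maps \<open>x - c y\<close> to
  \<open>A x - c y\<close>, so every competitor for \<open>x\<close> yields one for
  \<open>A x\<close>.\<close>

lemma quotient_norm_contraction:
  assumes "is_contraction N A" "A *v y = y"
  shows "quotient_norm y (A *v x) \<le> quotient_norm y x"
proof (rule quotient_norm_greatest)
  fix c
  have "quotient_norm y (A *v x) \<le> N (A *v (x - c *s y))"
    using quotient_norm_le[of y "A *v x" c] assms(2) by (simp add: vec.diff vec.scale)
  also have "\<dots> \<le> N (x - c *s y)" using assms(1) by (simp add: is_contraction_def)
  finally show "quotient_norm y (A *v x) \<le> N (x - c *s y)" .
qed

text \<open>A matrix that kills \<open>y\<close> factors through the quotient. This is the way back
  from the seminorm to the Euclidean norm, applied later to \<open>Q\<close>.\<close>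

lemma norm_le_quotient_norm:
  fixes T :: "complex ^ 'd ^ 'd"
  assumes T: "T *v y = 0" and K: "K > 0" "\<And>x. norm x \<le> K * N x"
  shows "norm (T *v x) \<le> onorm ((*v) T) * K * quotient_norm y x"
proof (rule quotient_norm_scale_greatest)
  have bl: "bounded_linear ((*v) T)" by (rule matrix_vector_mul_bounded_linear)
  show "0 \<le> onorm ((*v) T) * K" using K onorm_pos_le[OF bl] by simp
  fix c
  have "T *v x = T *v (x - c *s y)" by (simp add: vec.diff vec.scale T)
  also have "norm \<dots> \<le> onorm ((*v) T) * norm (x - c *s y)" by (rule onorm[OF bl])
  also have "\<dots> \<le> onorm ((*v) T) * (K * N (x - c *s y))"
    by (intro mult_left_mono K onorm_pos_le[OF bl])
  finally show "norm (T *v x) \<le> onorm ((*v) T) * K * N (x - c *s y)" by (simp add: algebra_simps)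
qed

end

subsection \<open>Powers and products of contractions\<close>

lemma poly_det:
  fixes B :: "'a::comm_ring_1 poly ^ 'd ^ 'd"
  shows "poly (det B) x = det (\<chi> i j. poly (B $ i $ j) x)"
  by (simp add: det_def poly_sum poly_prod)

lemma poly_characteristic_poly: "poly (characteristic_poly A) z = det (mat z - A)"
  unfolding characteristic_poly_def poly_det
  by (intro arg_cong[where f = det]) (simp add: vec_eq_iff mat_def)

lemma characteristic_poly_root_iff:
  fixes A :: "complex ^ 'd ^ 'd"
  shows "poly (characteristic_poly A) z = 0 \<longleftrightarrow> z \<in> mat_spectrum A"
  by (simp add: poly_characteristic_poly mat_spectrum_def invertible_det_nz)

lemma simple_eigenvalue_eigenspace:
  fixes A :: "complex ^ 'd ^ 'd"
  assumes simple: "simple_eigenvalue A z" and nz: "mat_spectrum A \<noteq> UNIV"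
    and y: "A *v y = z *s y" "y \<noteq> 0" and w: "A *v w = z *s w"
  shows "\<exists>c. w = c *s y"
proof (rule ccontr)
  \<comment> \<open>Two independent eigenvectors as columns of an invertible \<open>S\<close> make \<open>(X - z)\<^sup>2\<close> divide
    \<open>det ((X - A) S)\<close>, hence the characteristic polynomial.\<close>
  assume no: "\<nexists>c. w = c *s y"
  obtain i where i: "y $ i \<noteq> 0" using y(2) by (auto simp: vec_eq_iff)
  \<comment> \<open>Clearing coordinate \<open>i\<close> forces the nonzero entry \<open>j\<close>
    of \<open>w'\<close> to satisfy \<open>j \<noteq> i\<close>; \<open>S\<close> is then the
    identity with columns \<open>i\<close> and \<open>j\<close> replaced by \<open>y\<close> and
    \<open>w'\<close>.\<close>
  define w' where "w' = w - (w $ i / y $ i) *s y"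
  have w': "A *v w' = z *s w'" "w' $ i = 0" "w' \<noteq> 0"
    using y w i no unfolding w'_def
    by (auto simp: vec.diff vec.scale vec.scale_right_diff_distrib)
  then obtain j where j: "w' $ j \<noteq> 0" by (auto simp: vec_eq_iff)
  then have ij: "j \<noteq> i" using w'(2) by auto
  define S :: "complex ^ 'd ^ 'd" where
    "S = (\<chi> a b. if b = i then y $ a else if b = j then w' $ a else if a = b then 1 else 0)"
  have "x = 0" if "S *v x = 0" for x
  proof -
    have *: "y $ a * x $ i + w' $ a * x $ j + (if a \<noteq> i \<and> a \<noteq> j then x $ a else 0) = 0" for a
    proof -
      have "0 = (\<Sum>b\<in>UNIV. S $ a $ b * x $ b)"
        using that by (simp add: matrix_vector_mult_def vec_eq_iff)
      also have "\<dots> = (\<Sum>b\<in>UNIV. (if b = i then y $ a * x $ i else 0) + (if b = j then w' $ a * x $ j else 0)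
            + (if b = a then (if a \<noteq> i \<and> a \<noteq> j then x $ a else 0) else 0))"
        using ij by (intro sum.cong) (auto simp: S_def)
      also have "\<dots> = y $ a * x $ i + w' $ a * x $ j + (if a \<noteq> i \<and> a \<noteq> j then x $ a else 0)"
        by (simp add: sum.distrib)
      finally show ?thesis by simp
    qed
    have "x $ i = 0" using *[of i] i w'(2) by simp
    moreover have "x $ j = 0" using *[of j] j \<open>x $ i = 0\<close> by simp
    ultimately show "x = 0" using * by (simp add: vec_eq_iff) (metis (full_types))
  qed
  then have "invertible S"
    by (auto simp: invertible_left_inverse matrix_left_invertible_ker)
  then have detS: "det S \<noteq> 0" by (simp add: invertible_det_nz)
  define X :: "complex poly ^ 'd ^ 'd" where
    "X = (\<chi> i j. (if i = j then [:0, 1:] else 0) - [:A $ i $ j:])"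
  define cS :: "complex poly ^ 'd ^ 'd" where "cS = (\<chi> a b. [:S $ a $ b:])"
  \<comment> \<open>\<open>c\<close> holds the factors \<open>X - z\<close> to be pulled out of
    columns \<open>i\<close> and \<open>j\<close>, and \<open>T\<close> is what remains, stored
    transposed because \<open>det_rows_mul\<close> extracts factors from rows.\<close>
  define c :: "'d \<Rightarrow> complex poly" where "c b = (if b = i \<or> b = j then [:- z, 1:] else 1)" for b
  define T :: "complex poly ^ 'd ^ 'd" where
    "T = (\<chi> b a. if b = i \<or> b = j then cS $ a $ b else (X ** cS) $ a $ b)"
  have col: "(X ** cS) $ a $ b = [:0, 1:] * cS $ a $ b - [:(A *v column b S) $ a:]" for a b
  proof -
    have "(X ** cS) $ a $ b = (\<Sum>k\<in>UNIV. (if k = a then [:0, 1:] * cS $ a $ b else 0) - [:A $ a $ k * S $ k $ b:])"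
      unfolding matrix_matrix_mult_def
      by (auto simp: X_def cS_def left_diff_distrib intro!: sum.cong)
    also have "\<dots> = [:0, 1:] * cS $ a $ b - (\<Sum>k\<in>UNIV. [:A $ a $ k * S $ k $ b:])"
      by (simp add: sum_subtractf)
    also have "(\<Sum>k\<in>UNIV. [:A $ a $ k * S $ k $ b:]) = [:(A *v column b S) $ a:]"
      by (simp add: matrix_vector_mult_def column_def poly_eq_poly_eq_iff[symmetric] fun_eq_iff poly_sum)
    finally show ?thesis .
  qed
  have "column i S = y" "column j S = w'"
    using ij by (simp_all add: column_def S_def vec_eq_iff)
  then have "(X ** cS) $ a $ b = c b * T $ b $ a" for a b
    unfolding T_def c_def using col[of a b] y(1) w'(1) ij
    by (auto simp: cS_def S_def algebra_simps)
  then have "transpose (X ** cS) = (\<chi> b. c b *s T $ b)"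
    by (simp add: transpose_def vec_eq_iff)
  then have "det (X ** cS) = prod c UNIV * det T"
    using det_rows_mul[of c "\<lambda>b. T $ b"] det_transpose[of "X ** cS"] by simp
  also have "prod c UNIV = prod c {i, j}"
    by (intro prod.mono_neutral_right) (auto simp: c_def)
  also have "\<dots> = [:- z, 1:] ^ 2"
    using ij by (simp add: c_def power2_eq_square)
  finally have "[:- z, 1:] ^ 2 dvd det X * det cS"
    by (simp add: det_mul)
  also have "det cS = [:det S:]"
    by (simp add: poly_eq_poly_eq_iff[symmetric] fun_eq_iff poly_det cS_def)
  finally have "[:- z, 1:] ^ 2 dvd det X"
    using detS by (simp add: dvd_smult_iff)
  moreover have "det X = characteristic_poly A"
    by (simp add: X_def characteristic_poly_def)
  \<comment> \<open>Divisibility bounds \<open>order\<close> from below only for a nonzero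
    polynomial; a point outside the spectrum is not a root.\<close>
  moreover have "characteristic_poly A \<noteq> 0"
    using nz characteristic_poly_root_iff[of A] by (metis UNIV_eq_I poly_0)
  ultimately show False
    using simple unfolding simple_eigenvalue_def by (simp add: order_divides)
qed

section \<open>Decay of powers on the quotient and its stability under perturbation\<close>

lemma ordered_prod_const: "ordered_prod (\<lambda>_. A) n *v x = ((*v) A ^^ n) x"
  by (induction n arbitrary: x)
    (simp_all add: funpow_Suc_right matrix_vector_mul_assoc[symmetric] del: funpow.simps(2))

lemma ordered_prod_fixed:
  assumes "\<And>j. j \<in> {1..n} \<Longrightarrow> B j *v y = y"
  shows "ordered_prod B n *v y = y"
  using assms by (induction n) (simp_all add: matrix_vector_mul_assoc[symmetric])

text \<open>A crude entrywise bound; any constant depending on the dimension serves to choose a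
  radius in \<open>M_E_neighbourhood\<close>.\<close>

lemma norm_matrix_vector_mult_le:
  fixes T :: "complex ^ 'd ^ 'd"
  shows "norm (T *v x) \<le> real (CARD('d)) ^ 2 * norm T * norm x"
proof -
  have "norm (T *v x) \<le> (\<Sum>i\<in>UNIV. cmod ((T *v x) $ i))"
    unfolding norm_vec_def by (rule L2_set_le_sum) simp
  also have "\<dots> \<le> (\<Sum>i\<in>(UNIV :: 'd set). \<Sum>j\<in>(UNIV :: 'd set). norm T * norm x)"
  proof (rule sum_mono)
    fix i
    have "cmod ((T *v x) $ i) \<le> (\<Sum>j\<in>UNIV. cmod (T $ i $ j * x $ j))"
      unfolding matrix_vector_mult_def by (simp add: norm_sum)
    also have "\<dots> \<le> (\<Sum>j\<in>(UNIV :: 'd set). norm T * norm x)"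
      unfolding norm_mult
      by (intro sum_mono mult_mono order_trans[OF Finite_Cartesian_Product.norm_nth_le]
          Finite_Cartesian_Product.norm_nth_le) auto
    finally show "cmod ((T *v x) $ i) \<le> (\<Sum>j\<in>(UNIV :: 'd set). norm T * norm x)" .
  qed
  finally show ?thesis by (simp add: power2_eq_square)
qed

context complex_norm
begin

lemma spectrum_ne_UNIV:
  assumes "is_contraction N A"
  shows "mat_spectrum A \<noteq> UNIV"
proof -
  have "2 \<notin> mat_spectrum A" using eigenvalue_contraction[OF assms, of 2] by auto
  then show ?thesis by blast
qed

lemma finite_spectrum:
  assumes "is_contraction N A"
  shows "finite (mat_spectrum A)"
proof -
  have "characteristic_poly A \<noteq> 0"
    using spectrum_ne_UNIV[OF assms] characteristic_poly_root_iff[of A] by (metis UNIV_eq_I poly_0)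
  then have "finite {z. poly (characteristic_poly A) z = 0}" by (rule poly_roots_finite)
  then show ?thesis by (simp add: characteristic_poly_root_iff)
qed

text \<open>Peel off one eigenvalue: with \<open>w = (A - l) v\<close> one has
  \<open>A^(n+1) v = l A^n v + A^n w\<close>, where the last term tends to 0 in the quotient by
  induction. The seminorms of \<open>A^n v\<close> decrease to some \<open>L\<close> with
  \<open>L \<le> |l| L\<close>, so \<open>L = 0\<close>.\<close>

lemma linear_factors_stable:
  assumes A: "is_contraction N A" "A *v y = y"
    and ls: "\<And>l. l \<in> set ls \<Longrightarrow> cmod l < 1" and v: "linear_factors A ls v = c *s y"
  shows "(\<lambda>n. quotient_norm y (((*v) A ^^ n) v)) \<longlonglongrightarrow> 0"
  using ls v
proof (induction ls arbitrary: v)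
  case Nil
  have "((*v) A ^^ n) (c *s y) = c *s y" for n
    by (induction n) (simp_all add: vec.scale A)
  then show ?case using Nil by (simp add: quotient_norm_multiple)
next
  case (Cons l ls)
  let ?a = "\<lambda>n x. quotient_norm y (((*v) A ^^ n) x)"
  define w where "w = A *v v - l *s v"
  have w: "(\<lambda>n. ?a n w) \<longlonglongrightarrow> 0" using Cons.IH[of w] Cons.prems by (simp add: w_def)
  have pow: "((*v) A ^^ n) (l *s v + w) = l *s ((*v) A ^^ n) v + ((*v) A ^^ n) w" for n
    by (induction n) (simp_all add: vec.add vec.scale)
  have "((*v) A ^^ Suc n) v = l *s ((*v) A ^^ n) v + ((*v) A ^^ n) w" for n
    unfolding pow[symmetric] by (simp add: funpow_swap1 w_def)
  then have step: "?a (Suc n) v \<le> cmod l * ?a n v + ?a n w" for n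
    using quotient_norm_triangle[of y "l *s ((*v) A ^^ n) v"] quotient_norm_scale[of y l "((*v) A ^^ n) v"]
    by (smt (verit))
  have "decseq (\<lambda>n. ?a n v)"
    by (rule decseq_SucI) (simp add: quotient_norm_contraction[OF A])
  then obtain L where L: "(\<lambda>n. ?a n v) \<longlonglongrightarrow> L"
    by (rule decseq_convergent[where B = 0]) (simp add: quotient_norm_nonneg)
  then have "(\<lambda>n. ?a (Suc n) v) \<longlonglongrightarrow> L" by (rule LIMSEQ_Suc)
  moreover have "(\<lambda>n. cmod l * ?a n v + ?a n w) \<longlonglongrightarrow> cmod l * L + 0"
    by (intro tendsto_intros L w)
  ultimately have "L \<le> cmod l * L + 0"
    by (rule LIMSEQ_le) (use step in blast)
  moreover have "L \<ge> 0"
    using L quotient_norm_nonneg by (intro LIMSEQ_le_const) auto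
  moreover have "cmod l < 1" using Cons.prems by simp
  ultimately have "L = 0"
    using mult_strict_right_mono[of "cmod l" 1 L] by fastforce
  then show ?case using L by simp
qed

text \<open>Applying to \<open>v\<close> the factors of the eigenvalues other than 1 leaves a fixed
  vector of \<open>A\<close>, a multiple of \<open>y\<close> by simplicity; the eigenvalues used lie
  in the open unit disc.\<close>

lemma M_E_stable:
  assumes A: "A \<in> M_E N y" and y: "y \<noteq> 0"
  shows "(\<lambda>n. quotient_norm y (((*v) A ^^ n) v)) \<longlonglongrightarrow> 0"
proof -
  have con: "is_contraction N A" and fixed: "A *v y = y" and circ: "mat_spectrum A \<inter> sphere 0 1 = {1}"
    and simple: "simple_eigenvalue A 1"
    using A by (auto simp: M_E_def)
  obtain ls where ls: "set ls \<subseteq> mat_spectrum A - {1}" "linear_factors A ls (A *v v - v) = 0"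
    using linear_factors_annihilate_range[OF con] by blast
  have "A *v linear_factors A ls v = 1 *s linear_factors A ls v"
    using ls(2) linear_factors_commute[of A ls v 1] by simp
  then obtain c where "linear_factors A ls v = c *s y"
    using simple_eigenvalue_eigenspace[OF simple spectrum_ne_UNIV[OF con] _ y] fixed by fastforce
  moreover have "cmod l < 1" if "l \<in> set ls" for l
  proof -
    have "l \<in> mat_spectrum A" "l \<noteq> 1" using ls(1) that by auto
    then have "l \<notin> sphere 0 1" using circ by blast
    then show ?thesis
      using eigenvalue_contraction[OF con \<open>l \<in> mat_spectrum A\<close>] by simp
  qed
  ultimately show ?thesis using linear_factors_stable[OF con fixed] by blast
qed

lemma quotient_norm_sum: "quotient_norm y (\<Sum>i\<in>I. f i) \<le> (\<Sum>i\<in>I. quotient_norm y (f i))"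
proof (induction I rule: infinite_finite_induct)
  case (insert i I)
  then show ?case using quotient_norm_triangle[of y "f i" "\<Sum>i\<in>I. f i"] by simp
qed (use quotient_norm_multiple[of y 0] in simp_all)

text \<open>Decay on the finitely many basis vectors gives a bound uniform in \<open>z\<close> in
  terms of \<open>N z\<close>; it descends to the quotient because the power fixes
  \<open>y\<close>.\<close>

lemma M_E_power_small:
  assumes A: "A \<in> M_E N y" and y: "y \<noteq> 0" and \<epsilon>: "\<epsilon> > 0"
  obtains n where "n > 0" "\<And>x. quotient_norm y (ordered_prod (\<lambda>_. A) n *v x) \<le> \<epsilon> * quotient_norm y x"
proof -
  obtain K where K: "K > 0" "\<And>x. norm x \<le> K * N x" using norm_le_N by blast
  define s where "s n = (\<Sum>i\<in>UNIV. quotient_norm y (ordered_prod (\<lambda>_. A) n *v axis i 1))" for n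
  have "(\<lambda>n. K * s n) \<longlonglongrightarrow> K * (\<Sum>i\<in>(UNIV :: 'd set). 0)"
    unfolding s_def ordered_prod_const by (intro tendsto_intros M_E_stable A y)
  then have "eventually (\<lambda>n. K * s n < \<epsilon>) sequentially"
    using \<epsilon> by (intro order_tendstoD) auto
  then obtain n where n: "n > 0" "K * s n < \<epsilon>"
    using eventually_conj[OF _ eventually_gt_at_top[of 0]]
    by (metis (no_types, lifting) eventually_happens' sequentially_bot)
  let ?B = "ordered_prod (\<lambda>_. A) n"
  have By: "?B *v y = y"
    using A by (intro ordered_prod_fixed) (simp add: M_E_def)
  have bound: "quotient_norm y (?B *v z) \<le> \<epsilon> * N z" for z
  proof -
    have "?B *v z = ?B *v (\<Sum>i\<in>UNIV. z $ i *s axis i 1)" by (simp add: basis_expansion)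
    also have "\<dots> = (\<Sum>i\<in>UNIV. z $ i *s (?B *v axis i 1))" by (simp add: vec.sum vec.scale)
    also have "quotient_norm y \<dots> \<le> (\<Sum>i\<in>UNIV. quotient_norm y (z $ i *s (?B *v axis i 1)))"
      by (rule quotient_norm_sum)
    also have "\<dots> \<le> (\<Sum>i\<in>UNIV. norm z * quotient_norm y (?B *v axis i 1))"
      by (intro sum_mono order_trans[OF quotient_norm_scale] mult_right_mono quotient_norm_nonneg
          Finite_Cartesian_Product.norm_nth_le)
    also have "\<dots> = norm z * s n" by (simp add: s_def sum_distrib_left)
    also have "\<dots> \<le> (K * N z) * s n"
      unfolding s_def by (intro mult_right_mono K sum_nonneg quotient_norm_nonneg)
    also have "\<dots> = (K * s n) * N z" by simp
    also have "\<dots> \<le> \<epsilon> * N z" using n by (intro mult_right_mono) auto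
    finally show ?thesis .
  qed
  have "quotient_norm y (?B *v x) \<le> \<epsilon> * quotient_norm y x" for x
  proof (rule quotient_norm_scale_greatest)
    fix c
    have "?B *v x = ?B *v (x - c *s y) + c *s y" by (simp add: vec.diff vec.scale By)
    then have "quotient_norm y (?B *v x) \<le> quotient_norm y (?B *v (x - c *s y))"
      using quotient_norm_triangle[of y "?B *v (x - c *s y)" "c *s y"] by (simp add: quotient_norm_multiple)
    then show "quotient_norm y (?B *v x) \<le> \<epsilon> * N (x - c *s y)" using bound order_trans by blast
  qed (use \<epsilon> in simp)
  then show ?thesis using that n(1) by blast
qed

lemma quotient_norm_ordered_prod:
  assumes "\<And>j. j \<in> {1..n} \<Longrightarrow> is_contraction N (B j) \<and> B j *v y = y"
  shows "quotient_norm y (ordered_prod B n *v x) \<le> quotient_norm y x"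
  using assms
proof (induction n arbitrary: x)
  case (Suc n)
  have "quotient_norm y (ordered_prod B (Suc n) *v x) = quotient_norm y (ordered_prod B n *v (B (Suc n) *v x))"
    by (simp add: matrix_vector_mul_assoc)
  also have "\<dots> \<le> quotient_norm y (B (Suc n) *v x)" using Suc by simp
  also have "\<dots> \<le> quotient_norm y x" using Suc.prems by (intro quotient_norm_contraction) auto
  finally show ?case .
qed simp

text \<open>Replace the factors by \<open>A\<close> one at a time. Each replacement costs at most
  \<epsilon>, since the other factors contract the quotient seminorm.\<close>

lemma ordered_prod_perturbation:
  assumes B: "\<And>j. j \<in> {1..n} \<Longrightarrow> is_contraction N (B j) \<and> B j *v y = y"
    and A: "is_contraction N A" "A *v y = y" and \<epsilon>: "\<epsilon> \<ge> 0"
    and close: "\<And>j x. j \<in> {1..n} \<Longrightarrow> quotient_norm y ((B j - A) *v x) \<le> \<epsilon> * quotient_norm y x"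
  shows "quotient_norm y (ordered_prod B n *v x - ordered_prod (\<lambda>_. A) n *v x) \<le> real n * \<epsilon> * quotient_norm y x"
  using B close
proof (induction n arbitrary: x)
  case 0
  then show ?case using quotient_norm_multiple[of y 0] by simp
next
  case (Suc n)
  let ?P = "ordered_prod B n" and ?R = "ordered_prod (\<lambda>_. A) n"
  let ?z = "B (Suc n) *v x"
  have "ordered_prod B (Suc n) *v x - ordered_prod (\<lambda>_. A) (Suc n) *v x =
      (?P *v ?z - ?R *v ?z) + ?R *v ((B (Suc n) - A) *v x)"
    by (simp add: matrix_vector_mul_assoc[symmetric] matrix_vector_mult_diff_rdistrib vec.diff)
  then have "quotient_norm y (ordered_prod B (Suc n) *v x - ordered_prod (\<lambda>_. A) (Suc n) *v x)
      \<le> quotient_norm y (?P *v ?z - ?R *v ?z) + quotient_norm y (?R *v ((B (Suc n) - A) *v x))"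
    by (simp only: quotient_norm_triangle)
  also have "quotient_norm y (?R *v ((B (Suc n) - A) *v x)) \<le> quotient_norm y ((B (Suc n) - A) *v x)"
    using A by (intro quotient_norm_ordered_prod) auto
  also have "\<dots> \<le> \<epsilon> * quotient_norm y x" using Suc.prems by simp
  also have "quotient_norm y (?P *v ?z - ?R *v ?z) \<le> real n * \<epsilon> * quotient_norm y ?z"
    using Suc by simp
  also have "\<dots> \<le> real n * \<epsilon> * quotient_norm y x"
    using Suc.prems(1)[of "Suc n"] \<epsilon> by (intro mult_left_mono quotient_norm_contraction) auto
  finally show ?case by (simp add: algebra_simps)
qed

text \<open>A power of \<open>A\<close> contributes \<open>1 / 4\<close>, and the perturbation of
  its \<open>n\<close> factors another \<open>1 / 4\<close>.\<close>

lemma M_E_neighbourhood: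
  assumes A: "A \<in> M_E N y" and y: "y \<noteq> 0"
  obtains n \<delta> where "n > 0" "\<delta> > 0"
    "\<And>B x. (\<And>j. j \<in> {1..n} \<Longrightarrow> is_contraction N (B j) \<and> B j *v y = y \<and> dist (B j) A < \<delta>) \<Longrightarrow>
       quotient_norm y (ordered_prod B n *v x) \<le> 1 / 2 * quotient_norm y x"
proof -
  obtain n where n: "n > 0"
    "\<And>x. quotient_norm y (ordered_prod (\<lambda>_. A) n *v x) \<le> 1 / 4 * quotient_norm y x"
    using M_E_power_small[OF A y, of "1 / 4"] by auto
  obtain K where K: "K > 0" "\<And>x. norm x \<le> K * N x" using norm_le_N by blast
  obtain C where C: "C > 0" "\<And>x. N x \<le> C * norm x" using N_le_norm by blast
  \<comment> \<open>\<open>D\<close> converts the distance of matrices into a bound on the quotient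
    seminorm; \<delta> makes \<open>n\<close> perturbations add up to \<open>1 / 4\<close>.\<close>
  define D where "D = C * (real (CARD('d)) ^ 2 * K)"
  have D: "D > 0" using C K by (simp add: D_def)
  define \<delta> where "\<delta> = 1 / (4 * real n * D)"
  have \<delta>: "\<delta> > 0" using n D by (simp add: \<delta>_def)
  have Acon: "is_contraction N A" "A *v y = y" using A by (auto simp: M_E_def)
  have close: "quotient_norm y ((B - A) *v x) \<le> 1 / (4 * real n) * quotient_norm y x"
    if B: "B *v y = y" "dist B A < \<delta>" for B x
  proof (rule quotient_norm_scale_greatest)
    fix c
    \<comment> \<open>Both matrices fix \<open>y\<close>, so their difference kills it.\<close>
    have "(B - A) *v x = (B - A) *v (x - c *s y)"
      using B Acon by (simp add: vec.diff vec.scale matrix_vector_mult_diff_rdistrib)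
    then have "quotient_norm y ((B - A) *v x) \<le> N ((B - A) *v (x - c *s y))"
      using quotient_norm_le_N by simp
    also have "\<dots> \<le> C * norm ((B - A) *v (x - c *s y))" by (rule C)
    also have "\<dots> \<le> C * (real (CARD('d)) ^ 2 * norm (B - A) * norm (x - c *s y))"
      using C norm_matrix_vector_mult_le by (intro mult_left_mono) auto
    also have "\<dots> \<le> C * (real (CARD('d)) ^ 2 * \<delta> * (K * N (x - c *s y)))"
      using C K B(2) \<delta> by (intro mult_left_mono mult_mono) (auto simp: dist_norm)
    also have "\<dots> = 1 / (4 * real n) * N (x - c *s y)"
      using n C(1) K(1) by (simp add: \<delta>_def D_def field_simps)
    finally show "quotient_norm y ((B - A) *v x) \<le> 1 / (4 * real n) * N (x - c *s y)" .
  qed simp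
  show ?thesis
  proof (rule that[OF n(1) \<delta>])
    fix B x
    assume B: "\<And>j. j \<in> {1..n} \<Longrightarrow> is_contraction N (B j) \<and> B j *v y = y \<and> dist (B j) A < \<delta>"
    let ?R = "ordered_prod (\<lambda>_. A) n *v x"
    have "quotient_norm y (ordered_prod B n *v x - ?R) \<le> real n * (1 / (4 * real n)) * quotient_norm y x"
      using B by (intro ordered_prod_perturbation Acon close) auto
    then have "quotient_norm y (ordered_prod B n *v x - ?R) \<le> 1 / 4 * quotient_norm y x"
      using n(1) by simp
    then show "quotient_norm y (ordered_prod B n *v x) \<le> 1 / 2 * quotient_norm y x"
      using quotient_norm_triangle[of y "ordered_prod B n *v x - ?R" ?R] n(2)[of x] by simp
  qed
qed

end

subsection \<open>The Riesz projection of a contraction\<close>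

lemma resolvent_mult:
  fixes A :: "complex ^ 'd ^ 'd"
  assumes "z \<notin> mat_spectrum A"
  shows "matrix_inv (mat z - A) *v ((mat z - A) *v w) = w"
proof -
  have "\<exists>B. (mat z - A) ** B = mat 1 \<and> B ** (mat z - A) = mat 1"
    using assms by (simp add: mat_spectrum_def invertible_def)
  then have "matrix_inv (mat z - A) ** (mat z - A) = mat 1"
    unfolding matrix_inv_def by (rule someI2_ex) simp
  then show ?thesis by (simp add: matrix_vector_mul_assoc)
qed

text \<open>
  With \<open>w = (A - l) v\<close> one has \<open>(z - A)\<^sup>-\<^sup>1 v = ((z - A)\<^sup>-\<^sup>1 w + v) / (z - l)\<close>, so only the
  listed eigenvalues can be singularities of \<open>(z - A)\<^sup>-\<^sup>1 v\<close>.
\<close>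

lemma resolvent_holomorphic_extension:
  fixes A :: "complex ^ 'd ^ 'd"
  assumes "linear_factors A ls v = 0" "set ls \<inter> S = {}"
  shows "\<exists>F. (\<forall>i. (\<lambda>z. F z $ i) holomorphic_on S) \<and>
    (\<forall>z\<in>S - mat_spectrum A. matrix_inv (mat z - A) *v v = F z)"
  using assms
proof (induction ls arbitrary: v)
  case Nil
  then show ?case by (intro exI[of _ "\<lambda>_. 0"]) (simp add: vec.zero)
next
  case (Cons l ls)
  define w where "w = A *v v - l *s v"
  obtain G where G: "\<And>i. (\<lambda>z. G z $ i) holomorphic_on S"
    "\<And>z. z \<in> S - mat_spectrum A \<Longrightarrow> matrix_inv (mat z - A) *v w = G z"
    using Cons.IH[of w] Cons.prems by (auto simp: w_def)
  define F where "F z = (1 / (z - l)) *s (G z + v)" for z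
  have "(\<lambda>z. F z $ i) holomorphic_on S" for i
    unfolding F_def using Cons.prems(2) by (auto intro!: holomorphic_intros G)
  moreover have "matrix_inv (mat z - A) *v v = F z" if z: "z \<in> S - mat_spectrum A" for z
  proof -
    have zl: "z \<noteq> l" using z Cons.prems(2) by auto
    let ?R = "matrix_inv (mat z - A)"
    have "w = (z - l) *s v - (mat z - A) *v v"
      by (simp add: w_def mat_minus_vector_mult vec.scale_left_diff_distrib)
    then have "?R *v w = (z - l) *s (?R *v v) - v"
      using resolvent_mult[of z A v] z by (simp add: vec.diff vec.scale)
    then have G': "G z + v = (z - l) *s (?R *v v)" using G(2)[OF z] by (simp add: algebra_simps)
    show ?thesis using zl by (simp only: F_def G' vec.scale_scale) simp
  qed
  ultimately show ?case by blast
qed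

section \<open>The inner product and the projection \<open>P\<close>\<close>

lemma c_inner_add_right: "c_inner y (u + v) = c_inner y u + c_inner y v"
  and c_inner_scale_right: "c_inner y (c *s u) = c * c_inner y u"
  by (simp_all add: c_inner_def sum.distrib sum_distrib_left algebra_simps)

lemma c_inner_self:
  assumes "norm y = 1"
  shows "c_inner y y = 1"
proof -
  have "c_inner y y = (\<Sum>i\<in>UNIV. of_real ((cmod (y $ i))\<^sup>2))"
    unfolding c_inner_def by (intro sum.cong refl) (metis complex_norm_square mult.commute)
  also have "\<dots> = of_real ((norm y)\<^sup>2)"
    by (simp add: norm_vec_def L2_set_def sum_nonneg)
  finally show ?thesis using assms by simp
qed

lemma c_inner_adjoint: "c_inner (mat_adjoint R *v y) x = c_inner y (R *v x)"
proof -
  have "c_inner (mat_adjoint R *v y) x = (\<Sum>i\<in>UNIV. \<Sum>j\<in>UNIV. R $ j $ i * cnj (y $ j) * x $ i)"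
    by (simp add: c_inner_def mat_adjoint_def matrix_vector_mult_def sum_distrib_right)
  also have "\<dots> = (\<Sum>j\<in>UNIV. \<Sum>i\<in>UNIV. R $ j $ i * cnj (y $ j) * x $ i)"
    by (rule sum.swap)
  also have "\<dots> = c_inner y (R *v x)"
    by (simp add: c_inner_def matrix_vector_mult_def sum_distrib_left mult.assoc mult.left_commute)
  finally show ?thesis .
qed

lemma ket_bra_mult: "ket_bra y u *v x = c_inner u x *s y"
proof -
  have "Vector_Spaces.linear (*s) (*s) (\<lambda>v. c_inner u v *s y)"
    by unfold_locales
      (simp_all add: c_inner_add_right c_inner_scale_right vec.scale_left_distrib)
  then show ?thesis unfolding ket_bra_def by (rule matrix_works)
qed

text \<open>The adjoint in \<open>psi_vec\<close> cancels against the inner product, so properties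
  of \<open>P\<close> are read off the Riesz projection.\<close>

lemma P_mat_mult: "P_mat y A *v x = c_inner y (riesz_projection A 1 *v x) *s y"
  by (simp add: P_mat_def psi_vec_def ket_bra_mult c_inner_adjoint)

context complex_norm
begin

text \<open>On the range of \<open>A - 1\<close> the resolvent extends holomorphically across the
  eigenvalue 1, so Cauchy's theorem gives 0; on a fixed vector it acts as
  \<open>1 / (z - 1)\<close>, whose normalized integral is 1. Both are stated for all contractions
  because \<open>M(\<omega>)\<close> may lie outside \<open>M_E\<close>.\<close>

lemma riesz_projection_contraction:
  assumes A: "is_contraction N A"
  shows riesz_projection_range: "riesz_projection A 1 *v (A *v v - v) = 0"
    and riesz_projection_fixed: "A *v y = y \<Longrightarrow> riesz_projection A 1 *v y = y"
proof -
  let ?Q = "\<lambda>r. 0 < r \<and> mat_spectrum A \<inter> cball 1 r \<subseteq> {1}"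
  let ?R = "\<lambda>z. matrix_inv (mat z - A)"
  obtain d where d: "d > 0" "\<forall>x\<in>mat_spectrum A. x \<noteq> 1 \<longrightarrow> d \<le> dist 1 x"
    using finite_set_avoid[OF finite_spectrum[OF A], of 1] by blast
  have "x = 1" if "x \<in> mat_spectrum A \<inter> cball 1 (d / 2)" for x
    using that d by (cases "x = 1") fastforce+
  \<comment> \<open>The spectrum is finite, so an admissible radius exists, and the chosen radius is
    therefore admissible too.\<close>
  then have "?Q (d / 2)" using d(1) by auto
  then have "?Q (SOME r. ?Q r)" by (rule someI[where P = ?Q])
  moreover define r where "r = (SOME r. ?Q r)"
  ultimately have r: "0 < r" "mat_spectrum A \<inter> cball 1 r \<subseteq> {1}" by auto
  have sphere: "z \<notin> mat_spectrum A" if "z \<in> sphere 1 r" for z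
  proof
    assume "z \<in> mat_spectrum A"
    moreover have "z \<in> cball 1 r" using that by auto
    ultimately have "z = 1" using r(2) by blast
    then show False using that r(1) by auto
  qed
  have path: "path_image (circlepath 1 r) = sphere 1 r" using r(1) by simp
  \<comment> \<open>Column \<open>j\<close> of the resolvent is its value on a basis vector, which
    on the circle agrees with a holomorphic function since the circle avoids the spectrum.\<close>
  have int: "(\<lambda>z. ?R z $ i $ j) contour_integrable_on circlepath 1 r" for i j
  proof (rule contour_integrable_continuous_circlepath)
    obtain ls where ls: "set ls \<subseteq> mat_spectrum A" "linear_factors A ls (axis j 1) = 0"
      using linear_factors_annihilate_spectrum by blast
    have "set ls \<inter> sphere 1 r = {}" using ls(1) sphere by blast
    from resolvent_holomorphic_extension[OF ls(2) this]
    obtain F where F: "\<forall>i. (\<lambda>z. F z $ i) holomorphic_on sphere 1 r"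
        "\<forall>z\<in>sphere 1 r - mat_spectrum A. ?R z *v axis j 1 = F z"
      by (elim exE conjE)
    have "?R z $ i $ j = F z $ i" if "z \<in> sphere 1 r" for z
    proof -
      have "F z = ?R z *v axis j 1" using F(2) sphere that by auto
      then show ?thesis
        by (simp add: matrix_vector_mult_def axis_def if_distrib[of "\<lambda>x. _ * x"] cong: if_cong)
    qed
    then show "continuous_on (path_image (circlepath 1 r)) (\<lambda>z. ?R z $ i $ j)"
      unfolding path by (intro continuous_on_eq[OF holomorphic_on_imp_continuous_on[OF F(1)[rule_format]]]) simp
  qed
  have mult: "(riesz_projection A 1 *v x) $ i =
      1 / (2 * of_real pi * \<i>) * contour_integral (circlepath 1 r) (\<lambda>z. (?R z *v x) $ i)" for x i
  proof -
    have "contour_integral (circlepath 1 r) (\<lambda>z. (?R z *v x) $ i)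
        = (\<Sum>j\<in>UNIV. contour_integral (circlepath 1 r) (\<lambda>z. ?R z $ i $ j * x $ j))"
      unfolding matrix_vector_mult_def vec_lambda_beta
      by (intro contour_integral_sum contour_integrable_rmul int) simp
    also have "\<dots> = (\<Sum>j\<in>UNIV. contour_integral (circlepath 1 r) (\<lambda>z. ?R z $ i $ j) * x $ j)"
      by (intro sum.cong refl contour_integral_rmul int)
    finally show ?thesis
      by (simp add: riesz_projection_def r_def matrix_vector_mult_def sum_distrib_left mult.assoc Let_def)
  qed
  show "riesz_projection A 1 *v (A *v v - v) = 0"
  proof -
    obtain ls where ls: "set ls \<subseteq> mat_spectrum A - {1}" "linear_factors A ls (A *v v - v) = 0"
      using linear_factors_annihilate_range[OF A] by blast
    have "set ls \<inter> cball 1 r = {}" using ls(1) r(2) by blast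
    from resolvent_holomorphic_extension[OF ls(2) this]
    obtain F where F: "\<forall>i. (\<lambda>z. F z $ i) holomorphic_on cball 1 r"
        "\<forall>z\<in>cball 1 r - mat_spectrum A. ?R z *v (A *v v - v) = F z"
      by (elim exE conjE)
    have "contour_integral (circlepath 1 r) (\<lambda>z. (?R z *v (A *v v - v)) $ i) = 0" for i
    proof -
      have "contour_integral (circlepath 1 r) (\<lambda>z. (?R z *v (A *v v - v)) $ i)
          = contour_integral (circlepath 1 r) (\<lambda>z. F z $ i)"
        using F(2) sphere path by (intro contour_integral_eq) auto
      also have "\<dots> = 0"
        using r(1) by (intro contour_integral_unique Cauchy_theorem_convex_simple[OF F(1)[rule_format]]) auto
      finally show ?thesis .
    qed
    then show ?thesis by (simp add: vec_eq_iff mult)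
  qed
  show "riesz_projection A 1 *v y = y" if y: "A *v y = y"
  proof -
    have "?R z *v y = (1 / (z - 1)) *s y" if "z \<in> sphere 1 r" for z
    proof -
      have *: "(mat z - A) *v y = (z - 1) *s y"
        by (simp add: mat_minus_vector_mult y vec.scale_left_diff_distrib)
      have "(z - 1) *s (?R z *v y) = y"
        using resolvent_mult[OF sphere[OF that], of y] by (simp only: * vec.scale)
      moreover have "z \<noteq> 1" using that r(1) by auto
      ultimately show ?thesis
        using vec.scale_scale[of "1 / (z - 1)" "z - 1" "?R z *v y"] by (simp del: vec.scale_scale)
    qed
    then have "contour_integral (circlepath 1 r) (\<lambda>z. (?R z *v y) $ i)
        = contour_integral (circlepath 1 r) (\<lambda>z. (1 / (z - 1)) * y $ i)" for i
      using path by (intro contour_integral_eq) auto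
    also have "contour_integral (circlepath 1 r) (\<lambda>z. (1 / (z - 1)) * y $ i) = 2 * of_real pi * \<i> * y $ i" for i
    proof -
      have "continuous_on (path_image (circlepath 1 r)) (\<lambda>z. 1 / (z - 1))"
        using r(1) path by (auto intro!: continuous_intros)
      then show ?thesis
        using contour_integral_circlepath[OF r(1), of 1]
        by (subst contour_integral_rmul) (auto intro: contour_integrable_continuous_circlepath)
    qed
    finally show ?thesis by (simp add: vec_eq_iff mult)
  qed
qed

section \<open>The algebra of \<open>P\<close>, \<open>Q\<close> and \<open>M_Q\<close>\<close>

context
  fixes y :: "complex ^ 'd"
  assumes y: "norm y = 1"
begin

lemma P_mat_fixed:
  assumes "is_contraction N A" "A *v y = y"
  shows "P_mat y A *v y = y"
  using riesz_projection_fixed[OF assms] by (simp add: P_mat_mult c_inner_self y)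

lemma P_mat_absorb:
  assumes "is_contraction N A"
  shows "P_mat y A *v (A *v x) = P_mat y A *v x"
  using riesz_projection_range[OF assms, of x] by (simp add: P_mat_mult vec.diff)

lemma Q_mat_fixed:
  assumes "is_contraction N A" "A *v y = y"
  shows "Q_mat y A *v y = 0"
  using P_mat_fixed[OF assms] by (simp add: Q_mat_def matrix_vector_mult_diff_rdistrib)

text \<open>This is \<open>M_Q = M - P\<close>: the output of \<open>P\<close> is a multiple of
  \<open>y\<close>, which \<open>A\<close> fixes and \<open>Q\<close> kills, and
  \<open>P A = P\<close>.\<close>

lemma MQ_mat_mult:
  assumes A: "is_contraction N A" "A *v y = y"
  shows "MQ_mat y A *v x = A *v x - P_mat y A *v x"
proof -
  define p where "p = P_mat y A *v x"
  obtain c where c: "p = c *s y" by (auto simp: p_def P_mat_mult)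
  have "MQ_mat y A *v x = Q_mat y A *v (A *v (x - p))"
    by (simp add: MQ_mat_def matrix_vector_mul_assoc[symmetric] Q_mat_def[of y A]
        matrix_vector_mult_diff_rdistrib p_def)
  also have "A *v (x - p) = A *v x - c *s y" by (simp add: c vec.diff vec.scale A)
  also have "Q_mat y A *v (A *v x - c *s y) = Q_mat y A *v (A *v x)"
    using Q_mat_fixed[OF A] by (simp add: vec.diff vec.scale)
  also have "\<dots> = A *v x - P_mat y A *v x"
    by (simp add: Q_mat_def matrix_vector_mult_diff_rdistrib P_mat_absorb A)
  finally show ?thesis .
qed

text \<open>Each new right factor is \<open>M - P\<close>; the product of the \<open>M\<close>s
  fixes the output of \<open>P\<close>, and the leading \<open>Q\<close> then kills it. The count
  starts at \<open>Suc n\<close> because the empty product carries no \<open>Q\<close>.\<close>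

lemma ordered_prod_MQ_mat:
  assumes B: "\<And>j. j \<ge> 1 \<Longrightarrow> is_contraction N (B j) \<and> B j *v y = y"
  shows "ordered_prod (\<lambda>j. MQ_mat y (B j)) (Suc n) *v x = Q_mat y (B 1) *v (ordered_prod B (Suc n) *v x)"
proof (induction n arbitrary: x)
  case 0
  then show ?case
    using B[of 1] by (simp add: MQ_mat_mult Q_mat_def matrix_vector_mult_diff_rdistrib P_mat_absorb)
next
  case (Suc n)
  let ?m = "Suc (Suc n)" and ?Q = "Q_mat y (B 1)"
  obtain c where c: "P_mat y (B ?m) *v x = c *s y" by (auto simp: P_mat_mult)
  have fixed: "ordered_prod B (Suc n) *v y = y" using B by (intro ordered_prod_fixed) auto
  have "ordered_prod (\<lambda>j. MQ_mat y (B j)) ?m *v x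
      = ordered_prod (\<lambda>j. MQ_mat y (B j)) (Suc n) *v (B ?m *v x - c *s y)"
    using B[of ?m] c by (simp add: MQ_mat_mult matrix_vector_mul_assoc[symmetric])
  also have "\<dots> = ?Q *v (ordered_prod B (Suc n) *v (B ?m *v x - c *s y))" by (rule Suc.IH)
  also have "ordered_prod B (Suc n) *v (B ?m *v x - c *s y)
      = ordered_prod B (Suc n) *v (B ?m *v x) - c *s y"
    by (simp only: vec.diff vec.scale fixed)
  also have "?Q *v \<dots> = ?Q *v (ordered_prod B (Suc n) *v (B ?m *v x))"
    using Q_mat_fixed[of "B 1"] B[of 1] by (simp add: vec.diff vec.scale)
  also have "ordered_prod B (Suc n) *v (B ?m *v x) = ordered_prod B ?m *v x"
    by (simp add: matrix_vector_mul_assoc)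
  finally show ?case .
qed

end

end

subsection \<open>Independent blocks\<close>

text \<open>Each \<open>Y k\<close> has mean \<open>r = 1 - (1 - \<theta>) * prob E ^ l\<close>,
  which is below 1, and the \<open>Y k\<close> depend on disjoint sets of coordinates.\<close>

lemma AE_block_product_decay:
  fixes p :: "'a measure" and \<theta> :: real
  assumes "prob_space p" and E: "E \<in> sets p" "measure p E > 0" and l: "l > 0"
    and \<theta>: "0 < \<theta>" "\<theta> < 1"
  defines "Y \<equiv> \<lambda>k \<omega>. if \<forall>j\<in>{l * k + 1..l * k + l}. \<omega> j \<in> E then \<theta> else 1"
  obtains s where "0 < s" "s < 1"
    "AE \<omega> in PiM {1::nat..} (\<lambda>_. p). eventually (\<lambda>n. (\<Prod>k<n. Y k \<omega>) \<le> s ^ n) sequentially"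
proof -
  interpret p: prob_space p by fact
  interpret P: product_prob_space "\<lambda>_. p" "{1::nat..}" by unfold_locales
  note One_nat_def[simp del]
  let ?P = "PiM {1::nat..} (\<lambda>_. p)"
  define J where "J k = {l * k + 1..l * k + l}" for k :: nat
  have J: "J k \<subseteq> {1..}" "finite (J k)" "card (J k) = l" for k by (auto simp: J_def)
  define G where "G k = {\<omega> \<in> space ?P. \<forall>j\<in>J k. \<omega> j \<in> E}" for k
  \<comment> \<open>As a cylinder over \<open>l\<close> coordinates, \<open>G k\<close> is
    measurable and has probability \<open>prob E ^ l\<close>.\<close>
  have G_emb: "G k = prod_emb {1..} (\<lambda>_. p) (J k) (PiE (J k) (\<lambda>_. E))" for k
    using J(1)[of k] sets.sets_into_space[OF E(1)]
    by (auto simp: G_def prod_emb_def PiE_iff space_PiM extensional_def)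
  have G_sets: "G k \<in> sets ?P" for k
    unfolding G_emb using J E by (intro sets_PiM_I) auto
  have G_prob: "P.prob (G k) = p.prob E ^ l" for k
    unfolding G_emb using P.measure_PiM_emb[of "J k" "\<lambda>_. E"] J E by simp
  have Y_G: "Y k \<omega> = 1 - (1 - \<theta>) * indicator (G k) \<omega>" if "\<omega> \<in> space ?P" for k \<omega>
    using that by (simp add: Y_def G_def J_def indicator_def)
  define r where "r = 1 - (1 - \<theta>) * p.prob E ^ l"
  have pE: "0 < p.prob E ^ l" "p.prob E ^ l \<le> 1"
    using E(2) by (auto intro: power_le_one)
  have "(1 - \<theta>) * p.prob E ^ l \<le> (1 - \<theta>) * 1" "0 < (1 - \<theta>) * p.prob E ^ l"
    using \<theta> pE by (intro mult_left_mono mult_pos_pos; simp)+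
  then have r: "0 < r" "r < 1" using \<theta>(1) by (auto simp: r_def)
  \<comment> \<open>Independence of the coordinates means that their joint law is the product of the
    marginals, which holds here by construction.\<close>
  have indep_coord: "P.indep_vars (\<lambda>_. p) (\<lambda>j \<omega>. \<omega> j) {1..}"
  proof (subst P.indep_vars_iff_distr_eq_PiM')
    have "distr ?P ?P (\<lambda>x. \<lambda>i\<in>{1..}. x i) = distr ?P ?P (\<lambda>x. x)"
      by (intro distr_cong) (auto simp: space_PiM PiE_def extensional_def fun_eq_iff)
    moreover have "PiM {1..} (\<lambda>i. distr ?P p (\<lambda>x. x i)) = ?P"
      by (intro PiM_cong refl P.PiM_component) auto
    ultimately show "distr ?P ?P (\<lambda>x. \<lambda>i\<in>{1..}. x i) = PiM {1..} (\<lambda>i. distr ?P p (\<lambda>x. x i))"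
      by simp
  qed auto
  have disj: "disjoint_family_on J UNIV"
  proof (unfold disjoint_family_on_def, intro ballI impI)
    fix a b :: nat assume "a \<noteq> b"
    have "x = y" if "j \<in> J x" "j \<in> J y" for x y j
    proof -
      \<comment> \<open>Blocks start at \<open>l * k + 1\<close>, so the block index is recovered
        after subtracting 1.\<close>
      have "x = (j - 1) div l" if "j \<in> J x" for x
      proof -
        have "j - 1 = l * x + (j - 1 - l * x)" "j - 1 - l * x < l"
          using that l by (auto simp: J_def)
        then show ?thesis using l by (metis add.right_neutral div_less div_mult_self4 neq0_conv add.commute mult.commute)
      qed
      with that show ?thesis by metis
    qed
    then show "J a \<inter> J b = {}" using \<open>a \<noteq> b\<close> by blast
  qed
  have "P.indep_vars (\<lambda>k. PiM (J k) (\<lambda>_. p)) (\<lambda>k \<omega>. restrict (\<lambda>i. \<omega> i) (J k)) UNIV"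
    by (rule P.indep_vars_restrict[OF indep_coord _ disj]) (use J in auto)
  then have "P.indep_vars (\<lambda>_. borel) (\<lambda>k \<omega>. Y k (restrict (\<lambda>i. \<omega> i) (J k))) UNIV"
  proof (rule P.indep_vars_compose2)
    show "Y k \<in> borel_measurable (PiM (J k) (\<lambda>_. p))" for k
      unfolding Y_def J_def using E(1) by measurable
  qed
  moreover have "Y k (restrict (\<lambda>i. \<omega> i) (J k)) = Y k \<omega>" for k \<omega>
    by (simp add: Y_def J_def)
  ultimately have indep: "P.indep_vars (\<lambda>_. borel) Y UNIV" by simp
  have G_int: "integrable ?P (indicat_real (G k))" for k
    by (intro integrable_real_indicator[OF G_sets]) (simp add: less_top[symmetric])
  have Y_int: "integrable ?P (Y k)" for k
  proof -
    have "integrable ?P (\<lambda>\<omega>. 1 - (1 - \<theta>) * indicator (G k) \<omega>)"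
      by (intro Bochner_Integration.integrable_diff integrable_mult_right P.integrable_const G_int)
    then show ?thesis by (subst Bochner_Integration.integrable_cong[OF refl Y_G])
  qed
  have Y_exp: "P.expectation (Y k) = r" for k
  proof -
    have "P.expectation (Y k) = P.expectation (\<lambda>\<omega>. 1 - (1 - \<theta>) * indicator (G k) \<omega>)"
      by (intro Bochner_Integration.integral_cong Y_G) auto
    also have "\<dots> = P.expectation (\<lambda>_. 1) - P.expectation (\<lambda>\<omega>. (1 - \<theta>) * indicator (G k) \<omega>)"
      by (intro Bochner_Integration.integral_diff integrable_mult_right P.integrable_const G_int)
    also have "\<dots> = 1 - (1 - \<theta>) * P.prob (G k)"
      using G_sets P.P.prob_space by simp
    finally show ?thesis by (simp only: r_def G_prob)
  qed
  let ?Z = "\<lambda>n \<omega>. \<Prod>k<n. Y k \<omega>"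
  have indep_n: "P.indep_vars (\<lambda>_. borel) Y {..<n}" for n
    using indep by (rule P.indep_vars_subset) simp
  have Z_int: "integrable ?P (?Z n)" for n
    by (rule P.indep_vars_integrable[OF _ indep_n]) (auto intro: Y_int)
  have Z_exp: "P.expectation (?Z n) = r ^ n" for n
    by (subst P.indep_vars_lebesgue_integral[OF _ indep_n]) (auto intro: Y_int simp: Y_exp)
  \<comment> \<open>The square root balances Markov's inequality:
    \<open>r ^ n / s ^ n = s ^ n\<close>, which is summable.\<close>
  define s where "s = sqrt r"
  have s: "0 < s" "s < 1" "s * s = r" using r by (auto simp: s_def)
  define A where "A n = {\<omega> \<in> space ?P. s ^ n \<le> ?Z n \<omega>}" for n
  have A_sets: "A n \<in> sets ?P" for n
    unfolding A_def using borel_measurable_integrable[OF Z_int[of n]] by measurable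
  have "P.prob (A n) \<le> s ^ n" for n
  proof -
    have "P.prob (A n) \<le> P.expectation (?Z n) / s ^ n"
      unfolding A_def using s(1) \<theta>(1)
      by (intro integral_Markov_inequality_measure[OF Z_int sets.empty_sets])
        (auto intro!: prod_nonneg simp: Y_def)
    also have "\<dots> = s ^ n" using s(1) by (simp add: Z_exp s(3)[symmetric] power_mult_distrib)
    finally show ?thesis .
  qed
  then have "summable (\<lambda>n. P.prob (A n))"
    using s by (intro summable_comparison_test'[OF summable_geometric[of s]]) auto
  then have "AE \<omega> in ?P. eventually (\<lambda>n. \<omega> \<in> space ?P - A n) sequentially"
    using A_sets by (intro borel_cantelli_AE1) (auto simp: less_top[symmetric])
  then have "AE \<omega> in ?P. eventually (\<lambda>n. ?Z n \<omega> \<le> s ^ n) sequentially"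
    by eventually_elim (auto elim!: eventually_mono simp: A_def)
  with that s show ?thesis by blast
qed

text \<open>If every point of \<open>S\<close> had a ball of probability 0, countably many of these
  would cover \<open>S\<close>, and its preimage would lie in a null set.\<close>

lemma prob_ball_pos_of_prob_pos:
  fixes M :: "'a \<Rightarrow> 'b :: {metric_space, second_countable_topology}"
  assumes "prob_space p" and M: "M \<in> borel_measurable p"
    and pos: "measure p {\<omega> \<in> space p. M \<omega> \<in> S} > 0"
  obtains A where "A \<in> S" "\<And>\<delta>. \<delta> > 0 \<Longrightarrow> measure p {\<omega> \<in> space p. M \<omega> \<in> ball A \<delta>} > 0"
proof (rule ccontr)
  interpret prob_space p by fact
  note M[measurable]
  assume "\<not> thesis"
  then have "\<forall>A\<in>S. \<exists>\<delta>>0. prob {\<omega> \<in> space p. M \<omega> \<in> ball A \<delta>} = 0"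
    using that by (metis measure_nonneg less_eq_real_def)
  then obtain \<delta> where \<delta>: "\<And>A. A \<in> S \<Longrightarrow> \<delta> A > 0"
    "\<And>A. A \<in> S \<Longrightarrow> prob {\<omega> \<in> space p. M \<omega> \<in> ball A (\<delta> A)} = 0"
    by metis
  obtain F where F: "F \<subseteq> (\<lambda>A. ball A (\<delta> A)) ` S" "countable F" "\<Union>F = (\<Union>A\<in>S. ball A (\<delta> A))"
    using Lindelof[of "(\<lambda>A. ball A (\<delta> A)) ` S"] by auto
  have null: "(\<Union>U\<in>F. {\<omega> \<in> space p. M \<omega> \<in> U}) \<in> null_sets p"
  proof (rule null_sets_UN'[OF F(2)])
    fix U assume "U \<in> F"
    then obtain A where A: "A \<in> S" "U = ball A (\<delta> A)" using F(1) by blast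
    then have "M -` U \<inter> space p \<in> sets p" by (intro measurable_sets[OF M]) simp
    then have "{\<omega> \<in> space p. M \<omega> \<in> U} \<in> sets p" by (simp add: vimage_def Int_def conj_commute)
    then show "{\<omega> \<in> space p. M \<omega> \<in> U} \<in> null_sets p"
      using \<delta>(2)[OF A(1)] A(2) by (auto simp: null_sets_def emeasure_eq_measure)
  qed
  have sub: "{\<omega> \<in> space p. M \<omega> \<in> S} \<subseteq> (\<Union>U\<in>F. {\<omega> \<in> space p. M \<omega> \<in> U})"
  proof
    fix \<omega> assume \<omega>: "\<omega> \<in> {\<omega> \<in> space p. M \<omega> \<in> S}"
    then have "M \<omega> \<in> ball (M \<omega>) (\<delta> (M \<omega>))" using \<delta>(1) by simp
    then have "M \<omega> \<in> \<Union>F" using \<omega> unfolding F(3) by blast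
    then show "\<omega> \<in> (\<Union>U\<in>F. {\<omega> \<in> space p. M \<omega> \<in> U})" using \<omega> by blast
  qed
  \<comment> \<open>Monotonicity asks for measurability of the larger set only, here a countable
    union of null sets.\<close>
  have "prob {\<omega> \<in> space p. M \<omega> \<in> S} \<le> prob (\<Union>U\<in>F. {\<omega> \<in> space p. M \<omega> \<in> U})"
    by (rule finite_measure_mono[OF sub null_setsD2[OF null]])
  also have "\<dots> = 0" by (rule measure_eq_0_null_sets[OF null])
  finally show False using pos by simp
qed

section \<open>From decay per block to decay per factor\<close>

lemma ordered_prod_add:
  "ordered_prod B (m + n) = ordered_prod B m ** ordered_prod (\<lambda>j. B (m + j)) n"
  by (induction n) (simp_all add: matrix_mul_assoc)

text \<open>Rounding down loses less than one block, which costs at most a factor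
  \<open>1 / s\<close>; the sign of \<open>ln s\<close> reverses the inequality.\<close>

lemma power_div_le_exp:
  fixes s :: real
  assumes "0 < s" "s < 1" "l > 0"
  shows "s ^ (n div l) \<le> exp (ln s / real l * real n) / s"
proof -
  have "real n < real l * (real (n div l) + 1)"
    using dividend_less_times_div[of l n] assms(3)
    by (metis add.commute mult.commute mult_Suc of_nat_Suc of_nat_less_iff of_nat_mult)
  then have "real n / real l - 1 \<le> real (n div l)"
    using assms(3) by (simp add: field_simps)
  then have "real (n div l) * ln s \<le> (real n / real l - 1) * ln s"
    using assms by (intro mult_right_mono_neg) auto
  then have "exp (real (n div l) * ln s) \<le> exp (ln s / real l * real n - ln s)"
    by (simp add: algebra_simps)
  then show ?thesis
    using assms by (simp add: exp_diff exp_of_nat_mult)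
qed

text \<open>The \<open>n mod l\<close> factors after the last full block only contract.\<close>

lemma (in complex_norm) quotient_norm_ordered_prod_blocks:
  assumes B: "\<And>j. j \<ge> 1 \<Longrightarrow> is_contraction N (B j) \<and> B j *v y = y"
    and block: "\<And>k x. quotient_norm y (ordered_prod (\<lambda>j. B (l * k + j)) l *v x) \<le> c k * quotient_norm y x"
    and c: "\<And>k. 0 \<le> c k"
  shows "quotient_norm y (ordered_prod B n *v x) \<le> (\<Prod>k<n div l. c k) * quotient_norm y x"
proof -
  have blocks: "quotient_norm y (ordered_prod B (l * m) *v x) \<le> (\<Prod>k<m. c k) * quotient_norm y x" for m x
  proof (induction m arbitrary: x)
    case (Suc m)
    let ?z = "ordered_prod (\<lambda>j. B (l * m + j)) l *v x"
    have "ordered_prod B (l * Suc m) *v x = ordered_prod B (l * m) *v ?z"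
      using ordered_prod_add[of B "l * m" l] by (simp add: matrix_vector_mul_assoc add.commute)
    also have "quotient_norm y \<dots> \<le> (\<Prod>k<m. c k) * quotient_norm y ?z" by (rule Suc.IH)
    also have "\<dots> \<le> (\<Prod>k<m. c k) * (c m * quotient_norm y x)"
      by (intro mult_left_mono block prod_nonneg) (simp add: c)
    finally show ?case by (simp add: algebra_simps)
  qed simp
  let ?r = "ordered_prod (\<lambda>j. B (l * (n div l) + j)) (n mod l) *v x"
  have "ordered_prod B n *v x = ordered_prod B (l * (n div l)) *v ?r"
    using ordered_prod_add[of B "l * (n div l)" "n mod l"] by (simp add: matrix_vector_mul_assoc)
  also have "quotient_norm y \<dots> \<le> (\<Prod>k<n div l. c k) * quotient_norm y ?r" by (rule blocks)
  also have "\<dots> \<le> (\<Prod>k<n div l. c k) * quotient_norm y x"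
    using B by (intro mult_left_mono quotient_norm_ordered_prod prod_nonneg) (auto simp: c)
  finally show ?thesis .
qed

section \<open>The almost sure exponential bound\<close>

theorem theorem1:
  fixes p :: "'w measure"
    and M :: "'w \<Rightarrow> complex ^ 'd ^ 'd"
    and N :: "complex ^ 'd \<Rightarrow> real"
    and \<psi>S :: "complex ^ 'd"
  assumes "RRDO p M N \<psi>S"
    and "measure p {\<omega> \<in> space p. M \<omega> \<in> M_E N \<psi>S} > 0"
  shows "\<exists>\<Omega>1 \<in> sets (\<Pi>\<^sub>M j\<in>{1::nat..}. p). \<exists>C \<alpha> :: real. C > 0 \<and> \<alpha> > 0 \<and>
           measure (\<Pi>\<^sub>M j\<in>{1::nat..}. p) \<Omega>1 = 1 \<and>
           (\<forall>\<omega>\<in>\<Omega>1. \<exists>n0::nat. \<forall>n\<ge>n0.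
              onorm ((*v) (ordered_prod (\<lambda>j. MQ_mat \<psi>S (M (\<omega> j))) n)) \<le> C * exp (- \<alpha> * real n))"
proof -
  interpret RRDO p M N \<psi>S by fact
  interpret complex_norm N by unfold_locales (rule norm_N)
  let ?P = "PiM {1::nat..} (\<lambda>_. p)"
  interpret P: prob_space ?P by (intro prob_space_PiM prob_space_axioms)
  obtain A where A: "A \<in> M_E N \<psi>S"
    and ball: "\<And>\<delta>. \<delta> > 0 \<Longrightarrow> prob {\<omega> \<in> space p. M \<omega> \<in> ball A \<delta>} > 0"
    using prob_ball_pos_of_prob_pos[OF prob_space_axioms measurable_M assms(2)] by blast
  have "\<psi>S \<noteq> 0" using norm_\<psi>S by auto
  then obtain l \<delta> where l: "l > 0" and \<delta>: "\<delta> > 0" and contract: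
    "\<And>B x. (\<And>j. j \<in> {1..l} \<Longrightarrow> is_contraction N (B j) \<and> B j *v \<psi>S = \<psi>S \<and> dist (B j) A < \<delta>) \<Longrightarrow>
       quotient_norm \<psi>S (ordered_prod B l *v x) \<le> 1 / 2 * quotient_norm \<psi>S x"
    using M_E_neighbourhood[OF A] by blast
  define E where "E = {\<omega> \<in> space p. M \<omega> \<in> ball A \<delta>}"
  have "E = M -` ball A \<delta> \<inter> space p" by (auto simp: E_def)
  then have "E \<in> sets p" using measurable_sets[OF measurable_M] by simp
  have "prob E > 0" unfolding E_def by (rule ball[OF \<delta>])
  obtain s where s: "0 < s" "s < 1" and AE: "AE \<omega> in ?P. eventually (\<lambda>n.
      (\<Prod>k<n. if \<forall>j\<in>{l * k + 1..l * k + l}. \<omega> j \<in> E then 1 / 2 else 1 :: real) \<le> s ^ n) sequentially"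
    by (rule AE_block_product_decay[OF prob_space_axioms \<open>E \<in> sets p\<close> \<open>prob E > 0\<close> l, where \<theta> = "1 / 2"])
      (simp, simp, rule that, assumption+)
  obtain \<Omega>1 where \<Omega>1_sub: "\<Omega>1 \<subseteq> {\<omega> \<in> space ?P. eventually (\<lambda>n.
      (\<Prod>k<n. if \<forall>j\<in>{l * k + 1..l * k + l}. \<omega> j \<in> E then 1 / 2 else 1 :: real) \<le> s ^ n) sequentially}"
    and \<Omega>1: "\<Omega>1 \<in> sets ?P" "P.prob \<Omega>1 = 1"
    by (rule P.AE_E_prob[OF AE])
  \<comment> \<open>Half of the available rate \<open>- ln s / l\<close>; the other half absorbs the
    constant depending on \<omega>, so that the final constant can be 1.\<close>
  define \<alpha> where "\<alpha> = - ln s / (2 * real l)"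
  have \<alpha>: "\<alpha> > 0" using s l by (simp add: \<alpha>_def field_simps)
  obtain K where K: "K > 0" "\<And>x. norm x \<le> K * N x" using norm_le_N by blast
  obtain C where C: "C > 0" "\<And>x. N x \<le> C * norm x" using N_le_norm by blast
  have "\<exists>n0. \<forall>n\<ge>n0. onorm ((*v) (ordered_prod (\<lambda>j. MQ_mat \<psi>S (M (\<omega> j))) n)) \<le> 1 * exp (- \<alpha> * real n)"
    if "\<omega> \<in> \<Omega>1" for \<omega>
  proof -
    have \<omega>: "\<omega> j \<in> space p" if "j \<ge> 1" for j
      using that \<open>\<omega> \<in> \<Omega>1\<close> \<Omega>1_sub by (auto simp: space_PiM PiE_iff)
    define B where "B j = M (\<omega> j)" for j
    have B: "is_contraction N (B j) \<and> B j *v \<psi>S = \<psi>S" if "j \<ge> 1" for j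
      using \<omega>[OF that] contraction_M invariant_\<psi>S by (simp add: B_def)
    define c :: "nat \<Rightarrow> real" where
      "c k = (if \<forall>j\<in>{l * k + 1..l * k + l}. \<omega> j \<in> E then 1 / 2 else 1)" for k
    have c_nonneg: "0 \<le> c k" for k unfolding c_def by (split if_split) simp
    have block: "quotient_norm \<psi>S (ordered_prod (\<lambda>j. B (l * k + j)) l *v x) \<le> c k * quotient_norm \<psi>S x" for k x
    proof (cases "\<forall>j\<in>{l * k + 1..l * k + l}. \<omega> j \<in> E")
      case True
      then have "dist (B (l * k + j)) A < \<delta>" if "j \<in> {1..l}" for j
        using that by (force simp: E_def B_def dist_commute)
      then have "quotient_norm \<psi>S (ordered_prod (\<lambda>j. B (l * k + j)) l *v x) \<le> 1 / 2 * quotient_norm \<psi>S x"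
        using B by (intro contract) auto
      then show ?thesis using True by (simp add: c_def)
    next
      case False
      then have "c k = 1" by (simp only: c_def if_False)
      then show ?thesis
        using B quotient_norm_ordered_prod[of l "\<lambda>j. B (l * k + j)" \<psi>S x] by simp
    qed
    \<comment> \<open>This constant depends on the first coordinate of \<omega> through
      \<open>Q\<close>, so it is absorbed into the threshold \<open>n0\<close>.\<close>
    define a where "a = onorm ((*v) (Q_mat \<psi>S (B 1))) * K"
    have a: "a \<ge> 0"
      unfolding a_def using K(1)
      by (intro mult_nonneg_nonneg onorm_pos_le matrix_vector_mul_bounded_linear) simp
    \<comment> \<open>One of the two exponentials is grouped with the constants and eventually
      brings them below 1.\<close>
    have bound: "onorm ((*v) (ordered_prod (\<lambda>j. MQ_mat \<psi>S (B j)) n)) \<le> (a * C / s * exp (- \<alpha> * real n)) * exp (- \<alpha> * real n)"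
      if n: "n \<ge> 1" and prod: "(\<Prod>k<n div l. c k) \<le> s ^ (n div l)" for n
    proof (rule onorm_bound)
      show "0 \<le> (a * C / s * exp (- \<alpha> * real n)) * exp (- \<alpha> * real n)"
        using a C s by simp
      fix x
      obtain m where m: "n = Suc m" using n by (cases n) auto
      have "norm (ordered_prod (\<lambda>j. MQ_mat \<psi>S (B j)) n *v x) = norm (Q_mat \<psi>S (B 1) *v (ordered_prod B n *v x))"
        unfolding m by (subst ordered_prod_MQ_mat[OF norm_\<psi>S B]) simp_all
      also have "\<dots> \<le> a * quotient_norm \<psi>S (ordered_prod B n *v x)"
        unfolding a_def using B[of 1] by (intro norm_le_quotient_norm Q_mat_fixed norm_\<psi>S K) auto
      also have "\<dots> \<le> a * ((\<Prod>k<n div l. c k) * quotient_norm \<psi>S x)"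
        by (intro mult_left_mono quotient_norm_ordered_prod_blocks B block a c_nonneg)
      also have "\<dots> \<le> a * (exp (ln s / real l * real n) / s * (C * norm x))"
        using order_trans[OF quotient_norm_le_N C(2)] s
        by (intro mult_left_mono mult_mono order_trans[OF prod power_div_le_exp] a l quotient_norm_nonneg) auto
      also have "ln s / real l * real n = - \<alpha> * real n + - \<alpha> * real n"
        using l by (simp add: \<alpha>_def field_simps)
      finally show "norm (ordered_prod (\<lambda>j. MQ_mat \<psi>S (B j)) n *v x)
          \<le> (a * C / s * exp (- \<alpha> * real n)) * exp (- \<alpha> * real n) * norm x"
        unfolding exp_add by (simp add: algebra_simps)
    qed
    have "(\<lambda>n. a * C / s * exp (- \<alpha>) ^ n) \<longlonglongrightarrow> a * C / s * 0"
      using \<alpha> by (intro tendsto_intros LIMSEQ_realpow_zero) auto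
    then have "eventually (\<lambda>n. a * C / s * exp (- \<alpha>) ^ n < 1) sequentially"
      by (intro order_tendstoD) auto
    moreover have "eventually (\<lambda>n. (\<Prod>k<n. c k) \<le> s ^ n) sequentially"
      using \<open>\<omega> \<in> \<Omega>1\<close> \<Omega>1_sub unfolding c_def by blast
    \<comment> \<open>The number of full blocks tends to infinity with \<open>n\<close>.\<close>
    then have "eventually (\<lambda>n. (\<Prod>k<n div l. c k) \<le> s ^ (n div l)) sequentially"
      using filterlim_at_top_div_const_nat[OF l] by (rule eventually_compose_filterlim)
    moreover have "eventually (\<lambda>n. n \<ge> (1 :: nat)) sequentially" by (rule eventually_ge_at_top)
    ultimately have "eventually (\<lambda>n. onorm ((*v) (ordered_prod (\<lambda>j. MQ_mat \<psi>S (B j)) n)) \<le> 1 * exp (- \<alpha> * real n)) sequentially"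
    proof eventually_elim
      case (elim n)
      have "a * C / s * exp (- \<alpha> * real n) \<le> 1"
        using elim(1) by (simp add: exp_of_nat2_mult[symmetric])
      then show ?case
        using bound[OF elim(3,2)] by (meson exp_ge_zero mult_right_mono order_trans)
    qed
    then show ?thesis by (simp add: eventually_sequentially B_def)
  qed
  then show ?thesis
    using \<Omega>1 \<alpha> by (intro bexI[of _ \<Omega>1] exI[of _ 1] exI[of _ \<alpha>]) auto
qed

end
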